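(* Let $(p_0,p_1,p_3)$ be a probability vector with $p_0,p_1,p_3>0$, and let $\nu$ be the self-similar measure on $\mathbb{R}$ associated with the iterated function system $\{S_i(x)=\frac13x+i\}_{i\in\{0,1,3\}}$ and the weights $(p_0,p_1,p_3)$, i.e. the unique Borel probability measure with $\nu=\sum_{i\in\{0,1,3\}}p_i\,\nu\circ S_i^{-1}$. Then for every $r\in(0,\infty)$ the quantization dimension $D_r(\nu)$ of $\nu$ of order $r$ exists and $$D_r(\nu)=\chi_r,\qquad \chi_r:=\frac{r\,t_r}{1-t_r},$$ where $t_r\in(0,1)$ is the unique number in $(0,1)$ satisfying $p(t_r)=r\,t_r\log 3$, and $p$ is the pressure function defined in the context.
   Context: Alphabet $\mathcal{A}=\{0,1,3\}$. For a word $\mathbf{i}=(i_1,\dots,i_n)\in\mathcal{A}^n$ write $S_{\mathbf{i}}=S_{i_1}\circ\cdots\circ S_{i_n}$ and $p_{\mathbf{i}}=p_{i_1}\cdots p_{i_n}$. $\mathcal{T}_n=\{\mathbf{i}\in\mathcal{A}^n:(i_k,i_{k+1})\neq(0,3)\ \forall k<n\}$ and $\mathcal{U}_n=\{\mathbf{i}\in\mathcal{A}^n:(i_k,i_{k+1})\neq(1,0)\ \forall k<n\}$. Put $\mathcal{W}_n=\mathcal{T}_n$ if $p_1\ge p_3$ and $\mathcal{W}_n=\mathcal{U}_n$ if $p_3>p_1$. For $\mathbf{i}\in\mathcal{W}_n$ let $\mathcal{I}_{\mathbf{i}}=\{\boldsymbol{\eta}\in\mathcal{A}^n:S_{\boldsymbol{\eta}}=S_{\mathbf{i}}\}$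 and $\psi(\mathbf{i})=\sum_{\boldsymbol{\eta}\in\mathcal{I}_{\mathbf{i}}}p_{\boldsymbol{\eta}}$. For $t\ge0$, $$p(t):=\lim_{n\to\infty}\frac1n\log\sum_{\mathbf{i}\in\mathcal{W}_n}\psi(\mathbf{i})^t$$ (the limit exists). Quantization dimension: for a Borel probability measure $\mu$ on $\mathbb{R}$ and $r>0$, $V_{n,r}(\mu)=\inf\{\int d(x,\alpha)^r\,d\mu(x):\alpha\subset\mathbb{R},\ 1\le\operatorname{card}(\alpha)\le n\}$, where $d(x,\alpha)$ is the distance from $x$ to $\alpha$, and $e_{n,r}(\mu)=V_{n,r}(\mu)^{1/r}$. The lower and upper quantization dimensions of order $r$ are $\underline D_r(\mu)=\liminf_{n}\frac{\log n}{-\log e_{n,r}(\mu)}$ and $\overline D_r(\mu)=\limsup_n\frac{\log n}{-\log e_{n,r}(\mu)}$; if they coincide, the common value is the quantization dimension $D_r(\mu)$. *)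

theory Defs
  imports "HOL-Probability.Probability"
begin

section \<open>Quantization dimension\<close>

text \<open>The infimum is taken in the extended nonnegative reals, so that no moment assumption on
  the measure is built into the definition.\<close>

definition quant_V :: "nat \<Rightarrow> real \<Rightarrow> real measure \<Rightarrow> ennreal" where
  "quant_V n r \<mu> =
     (INF \<alpha>\<in>{\<alpha> :: real set. finite \<alpha> \<and> 1 \<le> card \<alpha> \<and> card \<alpha> \<le> n}.
        \<integral>\<^sup>+ x. ennreal (infdist x \<alpha> powr r) \<partial>\<mu>)"

text \<open>Conversion to the reals is meaningful when \<^term>\<open>quant_V n r \<mu>\<close> is finite, e.g. for
  every compactly supported probability measure and \<open>n \<ge> 1\<close>.\<close>

definition quant_e :: "nat \<Rightarrow> real \<Rightarrow> real measure \<Rightarrow> real" where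
  "quant_e n r \<mu> = enn2real (quant_V n r \<mu>) powr (1 / r)"

definition lower_quant_dim :: "real \<Rightarrow> real measure \<Rightarrow> ereal" where
  "lower_quant_dim r \<mu> = liminf (\<lambda>n. ereal (ln (real n) / (- ln (quant_e n r \<mu>))))"

definition upper_quant_dim :: "real \<Rightarrow> real measure \<Rightarrow> ereal" where
  "upper_quant_dim r \<mu> = limsup (\<lambda>n. ereal (ln (real n) / (- ln (quant_e n r \<mu>))))"

definition has_quant_dim :: "real \<Rightarrow> real measure \<Rightarrow> real \<Rightarrow> bool" where
  "has_quant_dim r \<mu> D \<longleftrightarrow>
     lower_quant_dim r \<mu> = upper_quant_dim r \<mu> \<and> upper_quant_dim r \<mu> = ereal D"

section \<open>The iterated function system and its self-similar measures\<close>

definition alphabet :: "nat set" where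
  "alphabet = {0, 1, 3}"

definition S :: "nat \<Rightarrow> real \<Rightarrow> real" where
  "S i x = x / 3 + real i"

text \<open>Only the values of the weight function on the alphabet matter.\<close>

definition positive_prob_vector :: "(nat \<Rightarrow> real) \<Rightarrow> bool" where
  "positive_prob_vector p \<longleftrightarrow> (\<forall>i\<in>alphabet. 0 < p i) \<and> (\<Sum>i\<in>alphabet. p i) = 1"

definition self_similar_measure :: "(nat \<Rightarrow> real) \<Rightarrow> real measure \<Rightarrow> bool" where
  "self_similar_measure p \<nu> \<longleftrightarrow>
     prob_space \<nu> \<and> sets \<nu> = sets borel \<and>
     (\<forall>A\<in>sets borel.
        emeasure \<nu> A = (\<Sum>i\<in>alphabet. ennreal (p i) * emeasure (distr \<nu> borel (S i)) A))"

section \<open>Words and the pressure function\<close>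

definition words :: "nat \<Rightarrow> nat list set" where
  "words n = {w. length w = n \<and> set w \<subseteq> alphabet}"

definition S_word :: "nat list \<Rightarrow> real \<Rightarrow> real" where
  "S_word w = foldr (\<circ>) (map S w) id"

definition p_word :: "(nat \<Rightarrow> real) \<Rightarrow> nat list \<Rightarrow> real" where
  "p_word p w = prod_list (map p w)"

definition T_words :: "nat \<Rightarrow> nat list set" where
  "T_words n = {w \<in> words n. \<forall>k. Suc k < n \<longrightarrow> (w ! k, w ! Suc k) \<noteq> (0, 3)}"

definition U_words :: "nat \<Rightarrow> nat list set" where
  "U_words n = {w \<in> words n. \<forall>k. Suc k < n \<longrightarrow> (w ! k, w ! Suc k) \<noteq> (1, 0)}"

definition W_words :: "(nat \<Rightarrow> real) \<Rightarrow> nat \<Rightarrow> nat list set" where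
  "W_words p n = (if p 1 \<ge> p 3 then T_words n else U_words n)"

definition same_map_words :: "nat list \<Rightarrow> nat list set" where
  "same_map_words w = {\<eta> \<in> words (length w). S_word \<eta> = S_word w}"

definition psi :: "(nat \<Rightarrow> real) \<Rightarrow> nat list \<Rightarrow> real" where
  "psi p w = (\<Sum>\<eta>\<in>same_map_words w. p_word p \<eta>)"

definition pressure_seq :: "(nat \<Rightarrow> real) \<Rightarrow> real \<Rightarrow> nat \<Rightarrow> real" where
  "pressure_seq p t n = 1 / real n * ln (\<Sum>w\<in>W_words p n. psi p w powr t)"

definition pressure :: "(nat \<Rightarrow> real) \<Rightarrow> real \<Rightarrow> real" where
  "pressure p t = lim (pressure_seq p t)"

definition pressure_root :: "(nat \<Rightarrow> real) \<Rightarrow> real \<Rightarrow> real \<Rightarrow> bool" where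
  "pressure_root p r t \<longleftrightarrow> 0 < t \<and> t < 1 \<and> pressure p t = r * t * ln 3"

definition t_root :: "(nat \<Rightarrow> real) \<Rightarrow> real \<Rightarrow> real" where
  "t_root p r = (THE t. pressure_root p r t)"

definition chi :: "(nat \<Rightarrow> real) \<Rightarrow> real \<Rightarrow> real" where
  "chi p r = r * t_root p r / (1 - t_root p r)"

end

theory Submission
  imports Defs
begin

text \<open>Every level-\<open>n\<close> map has the form \<open>x \<mapsto> (x + 3 N) / 3^n\<close> with \<open>N\<close> a natural number, so
  exact overlaps are coincidences of the integers \<open>N\<close>, and a point lies in at most two images of
  \<open>[0, 9/2]\<close> with distinct \<open>N\<close>. Let \<open>q\<^sub>n(N)\<close> be the total weight of the words of value \<open>N\<close>; the sums
  \<open>\<Sum>\<^sub>N q\<^sub>n(N)^t\<close> are submultiplicative in \<open>n\<close> for \<open>t \<le> 1\<close> and supermultiplicative for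
  \<open>t \<ge> 1\<close>, so Fekete's lemma gives the pressure.

  Call \<open>mass * length^r\<close> the energy of an interval. For \<open>s > t\<^sub>r\<close> the triadic intervals of energy
  at least \<open>\<epsilon>\<close> number \<open>O(\<epsilon>^(-s))\<close>, and quantizing by the endpoints of their children costs
  \<open>O(\<epsilon>^(1-s))\<close>. For \<open>s < t\<^sub>r\<close> the values \<open>N\<close> of one parity at a single large level define a
  subsystem with disjoint images whose energies satisfy \<open>\<Sum> e^s \<ge> 1\<close>; it contains at least
  \<open>\<epsilon>^(-s)\<close> separated intervals of energy at least \<open>c \<epsilon>\<close>, and each quantizing point is close to at
  most one of them. Letting \<open>s \<rightarrow> t\<^sub>r\<close> from both sides gives the dimension.\<close>

subsection \<open>Words and their base-3 values\<close>

text \<open>The base-3 value with the first letter most significant. The letter 3 exceeds the digits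
  of base 3, so distinct words can share a value: 03 and 10 both have value 3.\<close>

primrec val :: "nat list \<Rightarrow> nat" where
  "val [] = 0"
| "val (i # w) = i * 3 ^ length w + val w"

lemma val_append: "val (u @ v) = val u * 3 ^ length v + val v"
  by (induction u) (simp_all add: power_add algebra_simps)

lemma S_word_val: "S_word w x = (x + 3 * real (val w)) / 3 ^ length w"
proof (induction w)
  case (Cons i w)
  have "S_word (i # w) x = S i (S_word w x)" by (simp add: S_word_def)
  also have "\<dots> = (x + 3 * real (val (i # w))) / 3 ^ length (i # w)"
    unfolding Cons.IH S_def by (simp add: field_simps)
  finally show ?case .
qed (simp add: S_word_def)

text \<open>Exact overlaps become coincidences of integers: once the length is fixed, the image of 0
  determines the value.\<close>

lemma S_word_eq_iff:
  assumes "length u = length v"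
  shows "S_word u = S_word v \<longleftrightarrow> val u = val v"
proof
  assume "S_word u = S_word v"
  then have "S_word u 0 = S_word v 0" by simp
  then show "val u = val v" using assms by (simp add: S_word_val)
qed (use assms in \<open>auto simp: S_word_val\<close>)

lemma finite_words [simp]: "finite (words n)"
  using finite_lists_length_eq[of alphabet n]
  by (simp add: words_def alphabet_def conj_commute)

lemma words_0 [simp]: "words 0 = {[]}"
  by (auto simp: words_def)

lemma words_lengthD: "w \<in> words n \<Longrightarrow> length w = n"
  by (simp add: words_def)

lemma words_append: "words (m + n) = (\<lambda>(u, v). u @ v) ` (words m \<times> words n)"
proof
  show "words (m + n) \<subseteq> (\<lambda>(u, v). u @ v) ` (words m \<times> words n)"
  proof
    fix w assume w: "w \<in> words (m + n)"
    then have "take m w \<in> words m" "drop m w \<in> words n"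
      by (auto simp: words_def dest: in_set_takeD in_set_dropD)
    then show "w \<in> (\<lambda>(u, v). u @ v) ` (words m \<times> words n)"
      by (intro image_eqI[of _ _ "(take m w, drop m w)"]) auto
  qed
qed (auto simp: words_def)

lemma sum_words_append:
  fixes f :: "nat list \<Rightarrow> real"
  shows "(\<Sum>w\<in>words (m + n). f w) = (\<Sum>u\<in>words m. \<Sum>v\<in>words n. f (u @ v))"
proof -
  have "inj_on (\<lambda>(u, v). u @ v) (words m \<times> words n)"
    by (auto simp: inj_on_def words_def)
  then show ?thesis
    unfolding words_append sum.cartesian_product
    by (subst sum.reindex) (auto intro!: sum.cong)
qed

lemma words_1: "words (Suc 0) = (\<lambda>i. [i]) ` alphabet"
  by (auto simp: words_def length_Suc_conv)

lemma sum_words_Suc: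
  fixes f :: "nat list \<Rightarrow> real"
  shows "(\<Sum>w\<in>words (Suc n). f w) = (\<Sum>i\<in>alphabet. \<Sum>w\<in>words n. f (i # w))"
  using sum_words_append[of f 1 n] by (simp add: words_1 sum.reindex inj_on_def)

lemma Cons_words_iff: "i # w \<in> words (Suc n) \<longleftrightarrow> i \<in> alphabet \<and> w \<in> words n"
  by (auto simp: words_def)

lemma snoc_words_iff: "w @ [i] \<in> words (Suc n) \<longleftrightarrow> i \<in> alphabet \<and> w \<in> words n"
  by (auto simp: words_def)

lemma words_SucE:
  assumes "w \<in> words (Suc n)"
  obtains i u where "w = i # u" "i \<in> alphabet" "u \<in> words n"
  using assms by (cases w) (auto simp: words_def)

lemma words_SucE':
  assumes "w \<in> words (Suc n)"
  obtains i u where "w = u @ [i]" "i \<in> alphabet" "u \<in> words n"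
  using assms by (cases w rule: rev_cases) (auto simp: words_def)

text \<open>The extreme word 3...3 gives equality. In terms of intervals, this says that
  \<open>(3 * N + 9/2) / 3^n\<close> is at most 9/2, so all images of [0, 9/2] stay inside
  it.\<close>

lemma val_bound: "w \<in> words n \<Longrightarrow> 2 * val w + 3 \<le> 3 * 3 ^ n"
proof (induction n arbitrary: w)
  case (Suc n)
  then obtain i u where w: "w = i # u" "i \<in> alphabet" "u \<in> words n"
    by (elim words_SucE)
  have "i \<le> 3" using w(2) by (auto simp: alphabet_def)
  then have "i * 3 ^ n \<le> 3 * (3::nat) ^ n" by (rule mult_right_mono) simp
  moreover have "val w = i * 3 ^ n + val u" "3 * 3 ^ Suc n = 9 * (3::nat) ^ n"
    using w(1) words_lengthD[OF w(3)] by simp_all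
  ultimately show ?case using Suc.IH[OF w(3)] by linarith
qed simp

section \<open>Exactly one admissible word for each value\<close>

lemma val_mod_3:
  assumes "w \<in> words n"
  shows "val w mod 3 \<in> {0, 1}"
proof (cases w rule: rev_cases)
  case (snoc u i)
  then have "i \<in> alphabet" using assms by (auto simp: words_def)
  then show ?thesis using snoc by (auto simp: val_append alphabet_def)
qed simp

text \<open>The words are compared from the first letter. After a leading 0 the next letter is not
  3, which keeps the tail below \<open>3 ^ n\<close>; the size of the value then reveals the leading
  letter.\<close>

lemma T_words_inj: "\<lbrakk>u \<in> T_words n; v \<in> T_words n; val u = val v\<rbrakk> \<Longrightarrow> u = v"
proof (induction n arbitrary: u v)
  case (Suc n)
  have tail: "u' \<in> T_words n \<and> (i = 0 \<longrightarrow> val u' < 3 ^ n) \<and> i \<in> alphabet \<and> u' \<in> words n"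
    if T: "i # u' \<in> T_words (Suc n)" for i u'
  proof -
    have ok: "Suc k < Suc n \<Longrightarrow> ((i # u') ! k, (i # u') ! Suc k) \<noteq> (0, 3)" for k
      using T by (simp add: T_words_def)
    have W: "i \<in> alphabet" "u' \<in> words n"
      using T by (auto simp: T_words_def Cons_words_iff)
    have "u' \<in> T_words n"
      using W ok[of "Suc _"] by (auto simp: T_words_def)
    moreover have "val u' < 3 ^ n" if "i = 0"
    proof (cases n)
      case 0
      then show ?thesis using W by simp
    next
      case (Suc l)
      then obtain j u'' where u': "u' = j # u''" "j \<in> alphabet" "u'' \<in> words l"
        using W by (auto elim: words_SucE)
      have "j \<noteq> 3" using ok[of 0] u' that Suc by auto
      then have "j \<le> 1" using u' by (auto simp: alphabet_def)
      then have "j * 3 ^ l \<le> 1 * (3::nat) ^ l" by (rule mult_right_mono) simp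
      moreover have "val u' = j * 3 ^ l + val u''" "3 ^ n = 3 * (3::nat) ^ l"
        using u' words_lengthD[OF u'(3)] Suc by simp_all
      ultimately show ?thesis
        using val_bound[OF u'(3)] by linarith
    qed
    ultimately show ?thesis using W by blast
  qed
  from Suc.prems obtain i u' j v' where uv: "u = i # u'" "v = j # v'"
    unfolding T_words_def by (auto elim!: words_SucE)
  have tu: "u' \<in> T_words n" "i = 0 \<Longrightarrow> val u' < 3 ^ n" "i \<in> alphabet" "u' \<in> words n"
    using tail[of i u'] Suc.prems(1) unfolding uv by simp_all
  have tv: "v' \<in> T_words n" "j = 0 \<Longrightarrow> val v' < 3 ^ n" "j \<in> alphabet" "v' \<in> words n"
    using tail[of j v'] Suc.prems(2) unfolding uv by simp_all
  have eq: "i * 3 ^ n + val u' = j * 3 ^ n + val v'"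
    using Suc.prems(3) uv words_lengthD[OF tu(4)] words_lengthD[OF tv(4)] by simp
  have dj: "i = 0 \<or> i = 1 \<or> i = 3" "j = 0 \<or> j = 1 \<or> j = 3"
    using tu(3) tv(3) by (auto simp: alphabet_def)
  \<comment> \<open>With \<open>X = 3 ^ n\<close>, a leading 0, 1 or 3 puts the value in [0, X), in
    [X, 5X/2), or at or above 3X, and these ranges are disjoint.\<close>
  have key: "i = j"
    if "i = 0 \<or> i = 1 \<or> i = 3" "j = 0 \<or> j = 1 \<or> j = 3" "i * X + a = j * X + b"
      "i = 0 \<Longrightarrow> a < X" "j = 0 \<Longrightarrow> b < X" "2 * a + 3 \<le> 3 * X" "2 * b + 3 \<le> 3 * X" for a b X :: nat
    using that by (elim disjE) simp_all
  have "i = j"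
    using dj eq tu(2) tv(2) val_bound[OF tu(4)] val_bound[OF tv(4)]
    by (rule key[of "3 ^ n" "val u'" "val v'"])
  then show ?case using eq uv Suc.IH[OF tu(1) tv(1)] by simp
qed (simp add: T_words_def)

text \<open>The words are compared from the last letter. The residue modulo 3 singles out a final 1;
  the remaining confusion of 0 with 3 is excluded because a final 0 is not preceded by 1, so that
  the prefix has a value divisible by 3.\<close>

lemma U_words_inj: "\<lbrakk>u \<in> U_words n; v \<in> U_words n; val u = val v\<rbrakk> \<Longrightarrow> u = v"
proof (induction n arbitrary: u v)
  case (Suc n)
  have tail: "u' \<in> U_words n \<and> (i = 0 \<longrightarrow> val u' mod 3 = 0) \<and> i \<in> alphabet \<and> u' \<in> words n"
    if U: "u' @ [i] \<in> U_words (Suc n)" for i u'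
  proof -
    have ok: "Suc k < Suc n \<Longrightarrow> ((u' @ [i]) ! k, (u' @ [i]) ! Suc k) \<noteq> (1, 0)" for k
      using U by (simp add: U_words_def)
    have W: "i \<in> alphabet" "u' \<in> words n"
      using U by (auto simp: U_words_def snoc_words_iff)
    note len = words_lengthD[OF W(2)]
    have "(u' ! k, u' ! Suc k) \<noteq> (1, 0)" if "Suc k < n" for k
      using ok[of k] that len by (auto simp: nth_append)
    then have "u' \<in> U_words n"
      using W by (auto simp: U_words_def)
    moreover have "val u' mod 3 = 0" if "i = 0"
    proof (cases u' rule: rev_cases)
      case (snoc u'' j)
      then have "j \<noteq> 1" using ok[of "length u''"] that len by (auto simp: nth_append)
      moreover have "j \<in> alphabet" using W snoc by (auto simp: words_def)
      ultimately show ?thesis using snoc by (auto simp: val_append alphabet_def)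
    qed simp
    ultimately show ?thesis using W by blast
  qed
  from Suc.prems obtain i u' j v' where uv: "u = u' @ [i]" "v = v' @ [j]"
    unfolding U_words_def by (auto elim!: words_SucE')
  have tu: "u' \<in> U_words n" "i = 0 \<Longrightarrow> val u' mod 3 = 0" "i \<in> alphabet" "u' \<in> words n"
    using tail[of u' i] Suc.prems(1) unfolding uv by simp_all
  have tv: "v' \<in> U_words n" "j = 0 \<Longrightarrow> val v' mod 3 = 0" "j \<in> alphabet" "v' \<in> words n"
    using tail[of v' j] Suc.prems(2) unfolding uv by simp_all
  have eq: "3 * val u' + i = 3 * val v' + j"
    using Suc.prems(3) uv by (simp add: val_append)
  have m: "val u' mod 3 = 0 \<or> val u' mod 3 = 1" "val v' mod 3 = 0 \<or> val v' mod 3 = 1"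
    using val_mod_3[OF tu(4)] val_mod_3[OF tv(4)] by auto
  have dj: "i = 0 \<or> i = 1 \<or> i = 3" "j = 0 \<or> j = 1 \<or> j = 3"
    using tu(3) tv(3) by (auto simp: alphabet_def)
  have key: "i = j"
    if "i = 0 \<or> i = 1 \<or> i = 3" "j = 0 \<or> j = 1 \<or> j = 3" "3 * a + i = 3 * b + j"
      "i = 0 \<Longrightarrow> a mod 3 = 0" "j = 0 \<Longrightarrow> b mod 3 = 0"
      "a mod 3 = 0 \<or> a mod 3 = 1" "b mod 3 = 0 \<or> b mod 3 = 1" for a b :: nat
    using that(1,2)
  proof (elim disjE)
    \<comment> \<open>Here \<open>b\<close> would have residue 2 modulo 3, which no value has. The
      next case is symmetric, and the other ones contradict the residue of the common value.\<close>
    assume "i = 0" "j = 3"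
    then have "a = b + 1" "a mod 3 = 0" using that by auto
    then show ?thesis using that(7) by presburger
  next
    assume "i = 3" "j = 0"
    then have "b = a + 1" "b mod 3 = 0" using that by auto
    then show ?thesis using that(6) by presburger
  next
    assume "i = 0" "j = 1"
    then show ?thesis using that(3) by presburger
  next
    assume "i = 1" "j = 0"
    then show ?thesis using that(3) by presburger
  next
    assume "i = 1" "j = 3"
    then show ?thesis using that(3) by presburger
  next
    assume "i = 3" "j = 1"
    then show ?thesis using that(3) by presburger
  qed simp_all
  have "i = j" using dj eq tu(2) tv(2) m by (rule key[of "val u'" "val v'"])
  then show ?case using eq uv Suc.IH[OF tu(1) tv(1)] by simp
qed (simp add: U_words_def)

lemma split_consecutive:
  assumes "Suc k < length w" "w ! k = a" "w ! Suc k = b"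
  obtains xs ys where "w = xs @ a # b # ys"
proof
  show "w = take k w @ a # b # drop (Suc (Suc k)) w"
    using assms Cons_nth_drop_Suc[of k w] Cons_nth_drop_Suc[of "Suc k" w]
      append_take_drop_id[of k w] by simp
qed

text \<open>Rewriting 03 into 10 preserves the value and lowers the digit sum, so a word of
  minimal (maximal) digit sum among those with a given value lies in \<open>T\<close> (in \<open>U\<close>).\<close>

lemma T_words_surj:
  assumes "w \<in> words n"
  shows "\<exists>u\<in>T_words n. val u = val w"
proof -
  obtain u where u: "u \<in> words n" "val u = val w"
    and least: "\<And>v. v \<in> words n \<Longrightarrow> val v = val w \<Longrightarrow> sum_list u \<le> sum_list v"
    using ex_has_least_nat[of "\<lambda>u. u \<in> words n \<and> val u = val w" w sum_list] assms by auto
  have "(u ! k, u ! Suc k) \<noteq> (0, 3)" if k: "Suc k < n" for k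
  proof
    assume "(u ! k, u ! Suc k) = (0, 3)"
    then obtain xs ys where xy: "u = xs @ 0 # 3 # ys"
      using split_consecutive[of k u 0 3] k words_lengthD[OF u(1)] by auto
    have "xs @ 1 # 0 # ys \<in> words n" using u(1) unfolding xy words_def alphabet_def by auto
    moreover have "val (xs @ 1 # 0 # ys) = val w"
      using u(2) unfolding xy by (simp add: val_append)
    ultimately show False using least[of "xs @ 1 # 0 # ys"] unfolding xy by simp
  qed
  then show ?thesis using u by (auto simp: T_words_def)
qed

lemma U_words_surj:
  assumes "w \<in> words n"
  shows "\<exists>u\<in>U_words n. val u = val w"
proof -
  let ?C = "{u \<in> words n. val u = val w}"
  have C: "finite ?C" "?C \<noteq> {}" using assms by auto
  obtain u where u: "u \<in> words n" "val u = val w"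
    and greatest: "\<And>v. v \<in> words n \<Longrightarrow> val v = val w \<Longrightarrow> sum_list v \<le> sum_list u"
    using Max_in[of "sum_list ` ?C"] Max_ge[of "sum_list ` ?C"] C by fastforce
  have "(u ! k, u ! Suc k) \<noteq> (1, 0)" if k: "Suc k < n" for k
  proof
    assume "(u ! k, u ! Suc k) = (1, 0)"
    then obtain xs ys where xy: "u = xs @ 1 # 0 # ys"
      using split_consecutive[of k u 1 0] k words_lengthD[OF u(1)] by auto
    have "xs @ 0 # 3 # ys \<in> words n" using u(1) unfolding xy words_def alphabet_def by auto
    moreover have "val (xs @ 0 # 3 # ys) = val w"
      using u(2) unfolding xy by (simp add: val_append)
    ultimately show False using greatest[of "xs @ 0 # 3 # ys"] unfolding xy by simp
  qed
  then show ?thesis using u by (auto simp: U_words_def)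
qed

section \<open>The values attained at a level, as labels of its distinct maps\<close>

definition vals :: "nat \<Rightarrow> nat set" where
  "vals n = val ` words n"

text \<open>Both branches of \<open>W_words\<close> are systems of representatives of the level-n
  maps. This lets sums over admissible words be replaced by sums over \<open>vals n\<close>.\<close>

lemma bij_betw_val_W_words: "bij_betw val (W_words p n) (vals n)"
proof -
  have "W_words p n \<subseteq> words n"
    by (auto simp: W_words_def T_words_def U_words_def)
  moreover have "inj_on val (W_words p n)"
    unfolding W_words_def inj_on_def by (auto intro: T_words_inj U_words_inj)
  moreover have "vals n \<subseteq> val ` W_words p n"
  proof
    fix N assume "N \<in> vals n"
    then obtain w where "w \<in> words n" "N = val w" by (auto simp: vals_def)
    then show "N \<in> val ` W_words p n"
      using T_words_surj[of w n] U_words_surj[of w n] unfolding W_words_def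
      by (metis imageI)
  qed
  ultimately show ?thesis
    unfolding bij_betw_def vals_def by auto
qed

lemma finite_vals [simp]: "finite (vals n)"
  by (simp add: vals_def)

lemma vals_nonempty: "vals n \<noteq> {}"
proof -
  have "replicate n 0 \<in> words n" by (auto simp: words_def alphabet_def)
  then show ?thesis by (auto simp: vals_def)
qed

lemma vals_bound: "N \<in> vals n \<Longrightarrow> 2 * N + 3 \<le> 3 * 3 ^ n"
  by (auto simp: vals_def dest: val_bound)

lemma vals_add: "vals (m + n) = (\<lambda>(A, B). A * 3 ^ n + B) ` (vals m \<times> vals n)"
proof -
  have "vals (m + n) = (\<lambda>(u, v). val u * 3 ^ n + val v) ` (words m \<times> words n)"
    unfolding vals_def words_append image_image
    by (rule image_cong) (auto simp: val_append dest: words_lengthD)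
  also have "\<dots> = (\<lambda>(A, B). A * 3 ^ n + B) ` (vals m \<times> vals n)"
    unfolding vals_def by force
  finally show ?thesis .
qed

text \<open>Words in the letters 1 and 3 contain no 0, hence lie in \<open>T_words n\<close>, where
  \<open>val\<close> is injective.\<close>

lemma card_vals_ge: "2 ^ n \<le> card (vals n)"
proof -
  let ?L = "{w. set w \<subseteq> {1, 3::nat} \<and> length w = n}"
  have sub: "?L \<subseteq> T_words n"
  proof
    fix w assume w: "w \<in> ?L"
    have "w ! k \<noteq> 0" if "Suc k < n" for k
    proof -
      have "w ! k \<in> set w" using w that by simp
      then show ?thesis using w by auto
    qed
    then show "w \<in> T_words n"
      using w by (auto simp: T_words_def words_def alphabet_def)
  qed
  have "card (val ` ?L) = card ?L"
    by (rule card_image) (use sub in \<open>auto simp: inj_on_def intro: T_words_inj\<close>)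
  moreover have "card ?L = 2 ^ n" by (subst card_lists_length_eq) (auto simp: numeral_2_eq_2)
  moreover have "val ` ?L \<subseteq> vals n" using sub by (auto simp: vals_def T_words_def)
  ultimately show ?thesis
    using card_mono[of "vals n" "val ` ?L"] by simp
qed

subsection \<open>Fekete's lemma and power sums\<close>

text \<open>The limit is the infimum \<open>L\<close> of the quotients, which is finite by
  non-negativity. Writing \<open>n\<close> as a multiple of \<open>m\<close> plus a remainder bounds
  \<open>u n / n\<close> by \<open>u m / m\<close> up to an error of order
  \<open>1 / n\<close>.\<close>

lemma fekete_convergent:
  fixes u :: "nat \<Rightarrow> real"
  assumes sub: "\<And>m n. u (m + n) \<le> u m + u n" and nonneg: "\<And>n. 0 \<le> u n"
  shows "convergent (\<lambda>n. u n / real n)"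
proof -
  define L where "L = (INF n\<in>{1..}. u n / real n)"
  have bdd: "bdd_below ((\<lambda>n. u n / real n) ` {1..})"
    by (rule bdd_belowI2[of _ 0]) (simp add: nonneg)
  have L_le: "L \<le> u n / real n" if "n \<ge> 1" for n
    unfolding L_def by (rule cINF_lower[OF bdd]) (use that in simp)
  \<comment> \<open>The summand \<open>u 0\<close> pays for the case \<open>k = 0\<close>.\<close>
  have mult: "u (k * m) \<le> real k * u m + u 0" for k m
  proof (induction k)
    case (Suc k)
    then show ?case using sub[of m "k * m"] by (simp add: algebra_simps)
  qed simp
  have "(\<lambda>n. u n / real n) \<longlonglongrightarrow> L"
  proof (rule order_tendstoI)
    fix a assume "a < L"
    then show "\<forall>\<^sub>F n in sequentially. a < u n / real n"
      using L_le by (intro eventually_sequentiallyI[of 1]) force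
  next
    fix a assume "L < a"
    then obtain m where m: "m \<ge> 1" "u m / real m < a"
      unfolding L_def using cINF_less_iff[OF _ bdd] by auto
    \<comment> \<open>One constant for all remainders: the sum of the non-negative
      \<open>u s\<close> with \<open>s < m\<close> dominates each of them.\<close>
    define C where "C = u 0 + (\<Sum>s<m. u s)"
    have bound: "u n / real n \<le> u m / real m + C / real n" if "n \<ge> 1" for n
    proof -
      have "u n \<le> u (n div m * m) + u (n mod m)"
        using sub[of "n div m * m" "n mod m"] by simp
      moreover have "u (n mod m) \<le> (\<Sum>s<m. u s)"
        by (rule member_le_sum) (use m nonneg in auto)
      moreover have "real (n div m) * u m \<le> (real n / real m) * u m"
        by (rule mult_right_mono) (use nonneg in \<open>auto simp: of_nat_div_le_of_nat\<close>)
      ultimately have "u n \<le> (real n / real m) * u m + C"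
        using mult[of "n div m" m] by (simp add: C_def)
      then have "u n / real n \<le> ((real n / real m) * u m + C) / real n"
        by (rule divide_right_mono) simp
      then show ?thesis using that by (simp add: add_divide_distrib)
    qed
    have "(\<lambda>n. u m / real m + C / real n) \<longlonglongrightarrow> u m / real m + 0"
      by (intro tendsto_intros lim_const_over_n)
    then have "\<forall>\<^sub>F n in sequentially. u m / real m + C / real n < a"
      by (rule order_tendstoD) (use m in simp)
    then show "\<forall>\<^sub>F n in sequentially. u n / real n < a"
      using eventually_ge_at_top[of 1] by eventually_elim (use bound in force)
  qed
  then show ?thesis by (rule convergentI)
qed

text \<open>After division by the total every term \<open>x\<close> lies in [0, 1], where
  \<open>x \<le> x powr t\<close> for \<open>t \<le> 1\<close>. A vanishing total is covered by the
  convention \<open>0 powr t = 0\<close>.\<close>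

lemma sum_powr_le_sum:
  fixes f :: "'a \<Rightarrow> real"
  assumes "finite A" "\<And>i. i \<in> A \<Longrightarrow> 0 \<le> f i" "t \<le> 1"
  shows "sum f A powr t \<le> (\<Sum>i\<in>A. f i powr t)"
proof (cases "sum f A = 0")
  case False
  let ?s = "sum f A"
  have s: "?s > 0" using False sum_nonneg[of A f] assms by force
  have "1 = (\<Sum>i\<in>A. f i / ?s)" using s by (simp flip: sum_divide_distrib)
  also have "\<dots> \<le> (\<Sum>i\<in>A. (f i / ?s) powr t)"
  proof (rule sum_mono)
    fix i assume i: "i \<in> A"
    have "f i \<le> ?s" by (rule member_le_sum) (use assms i in auto)
    then show "f i / ?s \<le> (f i / ?s) powr t"
      using powr_mono'[of t 1 "f i / ?s"] assms i s by simp
  qed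
  also have "\<dots> = (\<Sum>i\<in>A. f i powr t) / ?s powr t"
    unfolding sum_divide_distrib by (rule sum.cong) (use assms s in \<open>auto simp: powr_divide\<close>)
  finally show ?thesis using s by (simp add: field_simps)
qed (auto intro: sum_nonneg)

lemma sum_le_sum_powr:
  fixes f :: "'a \<Rightarrow> real"
  assumes "finite A" "\<And>i. i \<in> A \<Longrightarrow> 0 \<le> f i" "1 \<le> t"
  shows "(\<Sum>i\<in>A. f i powr t) \<le> sum f A powr t"
proof (cases "sum f A = 0")
  case True
  then have "\<forall>i\<in>A. f i = 0" using assms by (simp add: sum_nonneg_eq_0_iff)
  then show ?thesis by (simp add: True)
next
  case False
  let ?s = "sum f A"
  have s: "?s > 0" using False sum_nonneg[of A f] assms by force
  have "(\<Sum>i\<in>A. f i powr t) / ?s powr t = (\<Sum>i\<in>A. (f i / ?s) powr t)"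
    unfolding sum_divide_distrib by (rule sum.cong) (use assms s in \<open>auto simp: powr_divide\<close>)
  also have "\<dots> \<le> (\<Sum>i\<in>A. f i / ?s)"
  proof (rule sum_mono)
    fix i assume i: "i \<in> A"
    have "f i \<le> ?s" by (rule member_le_sum) (use assms i in auto)
    then show "(f i / ?s) powr t \<le> f i / ?s"
      using powr_mono'[of 1 t "f i / ?s"] assms i s by simp
  qed
  also have "\<dots> = 1" using s by (simp flip: sum_divide_distrib)
  finally show ?thesis using s by (simp add: field_simps)
qed

subsection \<open>Weights of the maps of a given level\<close>

text \<open>The weight \<open>q\<^sub>n(N)\<close>, defined for every \<open>N\<close> and equal to
  0 off \<open>vals n\<close>, so that estimates may mention neighbouring indices that no word
  attains.\<close>

definition vweight :: "(nat \<Rightarrow> real) \<Rightarrow> nat \<Rightarrow> nat \<Rightarrow> real" where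
  "vweight p n N = (\<Sum>w\<in>{w \<in> words n. val w = N}. p_word p w)"

definition psum :: "(nat \<Rightarrow> real) \<Rightarrow> nat \<Rightarrow> real \<Rightarrow> real" where
  "psum p n t = (\<Sum>N\<in>vals n. vweight p n N powr t)"

lemma psi_eq_vweight:
  assumes "w \<in> words n"
  shows "psi p w = vweight p n (val w)"
proof -
  have "same_map_words w = {\<eta> \<in> words n. val \<eta> = val w}"
    unfolding same_map_words_def using assms S_word_eq_iff[of _ w]
    by (auto dest: words_lengthD)
  then show ?thesis by (simp add: psi_def vweight_def)
qed

lemma sum_psi_powr: "(\<Sum>w\<in>W_words p n. psi p w powr t) = psum p n t"
proof -
  have "(\<Sum>w\<in>W_words p n. psi p w powr t) = (\<Sum>w\<in>W_words p n. vweight p n (val w) powr t)"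
    by (rule sum.cong) (auto simp: W_words_def T_words_def U_words_def psi_eq_vweight split: if_splits)
  also have "\<dots> = psum p n t"
    unfolding psum_def by (rule sum.reindex_bij_betw[OF bij_betw_val_W_words])
  finally show ?thesis .
qed

lemma pressure_seq_psum: "pressure_seq p t n = ln (psum p n t) / real n"
  by (simp add: pressure_seq_def sum_psi_powr)

lemma p_word_append: "p_word p (u @ v) = p_word p u * p_word p v"
  by (simp add: p_word_def)

lemma sum_words_val:
  fixes f :: "nat \<Rightarrow> real"
  shows "(\<Sum>w\<in>words n. p_word p w * f (val w)) = (\<Sum>N\<in>vals n. vweight p n N * f N)"
proof -
  have "(\<Sum>w\<in>words n. p_word p w * f (val w)) =
      (\<Sum>N\<in>vals n. \<Sum>w\<in>{w \<in> words n. val w = N}. p_word p w * f (val w))"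
    unfolding vals_def by (rule sum.image_gen) simp
  also have "\<dots> = (\<Sum>N\<in>vals n. vweight p n N * f N)"
    unfolding vweight_def by (simp add: sum_distrib_right)
  finally show ?thesis .
qed

lemma vweight_eq_0: "N \<notin> vals n \<Longrightarrow> vweight p n N = 0"
  unfolding vweight_def vals_def by (intro sum.neutral) auto

text \<open>The weights convolve at scale \<open>3 ^ n\<close>: cut each word after \<open>m\<close>
  letters and group both halves by value. Several pairs can produce the same \<open>N\<close>, which
  is why the power sums are only sub- or supermultiplicative.\<close>

lemma vweight_add:
  "vweight p (m + n) N =
     (\<Sum>(A, B)\<in>{x \<in> vals m \<times> vals n. (case x of (A, B) \<Rightarrow> A * 3 ^ n + B) = N}.
        vweight p m A * vweight p n B)"
proof -
  \<comment> \<open>The constraint on the value is carried as a 0-1 factor, so that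
    \<open>sum_words_val\<close> can regroup first the suffixes and then the prefixes.\<close>
  have "vweight p (m + n) N = (\<Sum>w\<in>words (m + n). p_word p w * (if val w = N then 1 else 0))"
    unfolding vweight_def by (subst sum.inter_filter) (auto intro!: sum.cong)
  also have "\<dots> = (\<Sum>u\<in>words m. p_word p u * (\<Sum>v\<in>words n. p_word p v *
      (if val u * 3 ^ n + val v = N then 1 else 0)))"
    unfolding sum_words_append sum_distrib_left
    by (intro sum.cong refl) (auto simp: p_word_append val_append dest!: words_lengthD)
  also have "\<dots> = (\<Sum>u\<in>words m. p_word p u * (\<Sum>B\<in>vals n. vweight p n B *
      (if val u * 3 ^ n + B = N then 1 else 0)))"
    by (intro sum.cong refl arg_cong2[of _ _ _ _ "(*)"]
        sum_words_val[of p "\<lambda>B. if val _ * 3 ^ n + B = N then 1 else 0"])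
  also have "\<dots> = (\<Sum>A\<in>vals m. vweight p m A * (\<Sum>B\<in>vals n. vweight p n B *
      (if A * 3 ^ n + B = N then 1 else 0)))"
    by (rule sum_words_val[of p "\<lambda>A. \<Sum>B\<in>vals n. vweight p n B *
      (if A * 3 ^ n + B = N then 1 else 0)"])
  also have "\<dots> = (\<Sum>(A, B)\<in>vals m \<times> vals n. if A * 3 ^ n + B = N
      then vweight p m A * vweight p n B else 0)"
    by (auto simp: sum_distrib_left sum.cartesian_product intro!: sum.cong)
  also have "\<dots> = (\<Sum>x\<in>vals m \<times> vals n. if (case x of (A, B) \<Rightarrow> A * 3 ^ n + B) = N
      then (case x of (A, B) \<Rightarrow> vweight p m A * vweight p n B) else 0)"
    by (intro sum.cong refl) (simp add: case_prod_unfold)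
  finally show ?thesis by (simp add: sum.inter_filter)
qed

locale weights =
  fixes p :: "nat \<Rightarrow> real"
  assumes prob: "positive_prob_vector p"
begin

lemma p_pos: "i \<in> alphabet \<Longrightarrow> 0 < p i"
  using prob by (simp add: positive_prob_vector_def)

lemma sum_p: "sum p alphabet = 1"
  using prob by (simp add: positive_prob_vector_def)

lemma p_word_pos: "w \<in> words n \<Longrightarrow> 0 < p_word p w"
proof (induction n arbitrary: w)
  case (Suc n)
  then show ?case by (auto elim!: words_SucE simp: p_word_def p_pos)
qed (simp add: p_word_def)

lemma sum_p_word: "(\<Sum>w\<in>words n. p_word p w) = 1"
proof (induction n)
  case (Suc n)
  then show ?case
    by (simp add: sum_words_Suc p_word_def sum_p flip: sum_distrib_left)
qed (simp add: p_word_def)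

lemma vweight_nonneg: "0 \<le> vweight p n N"
  unfolding vweight_def by (auto intro!: sum_nonneg less_imp_le[OF p_word_pos])

lemma vweight_pos: "N \<in> vals n \<Longrightarrow> 0 < vweight p n N"
  unfolding vweight_def vals_def by (rule sum_pos) (auto intro: p_word_pos)

lemma sum_vweight: "(\<Sum>N\<in>vals n. vweight p n N) = 1"
  using sum_words_val[of p "\<lambda>_. 1" n] by (simp add: sum_p_word)

lemma vweight_le_1: "vweight p n N \<le> 1"
proof (cases "N \<in> vals n")
  case True
  have "vweight p n N \<le> (\<Sum>N\<in>vals n. vweight p n N)"
    by (rule member_le_sum) (use True vweight_nonneg in auto)
  then show ?thesis by (simp add: sum_vweight)
qed (simp add: vweight_eq_0)

text \<open>The product is a single non-negative term of the convolution.\<close>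

lemma vweight_mult_le:
  assumes "A \<in> vals m" "B \<in> vals n"
  shows "vweight p m A * vweight p n B \<le> vweight p (m + n) (A * 3 ^ n + B)"
proof -
  let ?F = "{x \<in> vals m \<times> vals n. (case x of (A, B) \<Rightarrow> A * 3 ^ n + B) = A * 3 ^ n + B}"
  have "(case (A, B) of (A, B) \<Rightarrow> vweight p m A * vweight p n B) \<le>
      (\<Sum>(A, B)\<in>?F. vweight p m A * vweight p n B)"
    by (rule member_le_sum) (use assms vweight_nonneg in auto)
  then show ?thesis by (simp add: vweight_add)
qed

text \<open>The product is arranged by the fibres of the convolution, so that it can be compared
  with \<open>psum p (m + n) t\<close> one value at a time.\<close>

lemma psum_mult:
  "psum p m t * psum p n t =
     (\<Sum>N\<in>vals (m + n). \<Sum>(A, B)\<in>{x \<in> vals m \<times> vals n. (case x of (A, B) \<Rightarrow> A * 3 ^ n + B) = N}.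
        (vweight p m A * vweight p n B) powr t)"
proof -
  have "psum p m t * psum p n t = (\<Sum>(A, B)\<in>vals m \<times> vals n. (vweight p m A * vweight p n B) powr t)"
    unfolding psum_def sum_product sum.cartesian_product by (simp add: powr_mult vweight_nonneg)
  also have "\<dots> = (\<Sum>N\<in>(\<lambda>(A, B). A * 3 ^ n + B) ` (vals m \<times> vals n).
      \<Sum>(A, B)\<in>{x \<in> vals m \<times> vals n. (case x of (A, B) \<Rightarrow> A * 3 ^ n + B) = N}.
        (vweight p m A * vweight p n B) powr t)"
    by (rule sum.image_gen) simp
  finally show ?thesis by (simp only: vals_add)
qed

lemma psum_submult:
  assumes "t \<le> 1"
  shows "psum p (m + n) t \<le> psum p m t * psum p n t"
  unfolding psum_mult unfolding psum_def
proof (rule sum_mono)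
  fix N
  show "vweight p (m + n) N powr t \<le> (\<Sum>(A, B)\<in>{x \<in> vals m \<times> vals n.
      (case x of (A, B) \<Rightarrow> A * 3 ^ n + B) = N}. (vweight p m A * vweight p n B) powr t)"
    unfolding vweight_add case_prod_unfold
    by (rule sum_powr_le_sum) (use assms vweight_nonneg in \<open>auto intro: finite_subset[of _ "vals m \<times> vals n"]\<close>)
qed

lemma psum_supermult:
  assumes "1 \<le> t"
  shows "psum p m t * psum p n t \<le> psum p (m + n) t"
  unfolding psum_mult unfolding psum_def
proof (rule sum_mono)
  fix N
  show "(\<Sum>(A, B)\<in>{x \<in> vals m \<times> vals n. (case x of (A, B) \<Rightarrow> A * 3 ^ n + B) = N}.
      (vweight p m A * vweight p n B) powr t) \<le> vweight p (m + n) N powr t"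
    unfolding vweight_add case_prod_unfold
    by (rule sum_le_sum_powr) (use assms vweight_nonneg in \<open>auto intro: finite_subset[of _ "vals m \<times> vals n"]\<close>)
qed

section \<open>Bounds on the power sums, and the pressure as their growth rate\<close>

lemma psum_pos: "0 < psum p n t"
  unfolding psum_def by (rule sum_pos) (use vals_nonempty vweight_pos in force)+

lemma psum_1: "psum p n 1 = 1"
  by (simp add: psum_def vweight_nonneg sum_vweight)

lemma psum_antimono:
  assumes "s \<le> t"
  shows "psum p n t \<le> psum p n s"
  unfolding psum_def
  by (intro sum_mono powr_mono') (use assms vweight_nonneg vweight_le_1 in auto)

lemma psum_0: "psum p n 0 = card (vals n)"
proof -
  have "psum p n 0 = (\<Sum>N\<in>vals n. 1)"
    unfolding psum_def by (rule sum.cong) (use vweight_pos in force)+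
  then show ?thesis by simp
qed

text \<open>Since \<open>psum p n 1 = 1\<close> and the power sums decrease in \<open>t\<close>,
  their logarithms are non-negative and subadditive for \<open>t \<le> 1\<close>; for
  \<open>t \<ge> 1\<close> the same is true of the negated logarithms.\<close>

lemma convergent_pressure_seq: "convergent (pressure_seq p t)"
proof (cases "t \<le> 1")
  case True
  have "convergent (\<lambda>n. ln (psum p n t) / real n)"
  proof (rule fekete_convergent)
    fix m n
    have "ln (psum p (m + n) t) \<le> ln (psum p m t * psum p n t)"
      using psum_submult[OF True] psum_pos by simp
    then show "ln (psum p (m + n) t) \<le> ln (psum p m t) + ln (psum p n t)"
      using psum_pos[of m t] psum_pos[of n t] by (simp add: ln_mult)
    show "0 \<le> ln (psum p n t)"
      using psum_antimono[OF True, of n] psum_1 by simp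
  qed
  then show ?thesis by (simp add: pressure_seq_psum[abs_def])
next
  case False
  then have t: "1 \<le> t" by simp
  have "convergent (\<lambda>n. - ln (psum p n t) / real n)"
  proof (rule fekete_convergent)
    fix m n
    have "ln (psum p m t * psum p n t) \<le> ln (psum p (m + n) t)"
      using psum_supermult[OF t] psum_pos by simp
    then show "- ln (psum p (m + n) t) \<le> - ln (psum p m t) + - ln (psum p n t)"
      using psum_pos[of m t] psum_pos[of n t] by (simp add: ln_mult)
    show "0 \<le> - ln (psum p n t)"
      using psum_antimono[OF t, of n] psum_1 psum_pos by simp
  qed
  then show ?thesis
    by (subst (asm) convergent_minus_iff) (simp add: pressure_seq_psum[abs_def])
qed

lemma pressure_lim: "(\<lambda>n. ln (psum p n t) / real n) \<longlonglongrightarrow> pressure p t"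
  using convergent_pressure_seq[of t]
  by (simp add: convergent_LIMSEQ_iff pressure_def pressure_seq_psum[abs_def])

lemma pressure_1: "pressure p 1 = 0"
  using pressure_lim[of 1] LIMSEQ_unique[of "\<lambda>_. 0::real"] by (simp add: psum_1)

lemma pressure_antimono:
  assumes "s \<le> t"
  shows "pressure p t \<le> pressure p s"
  by (rule LIMSEQ_le[OF pressure_lim pressure_lim])
     (use psum_antimono[OF assms] psum_pos in \<open>auto intro!: exI[of _ 1] divide_right_mono\<close>)

lemma pressure_0: "ln 2 \<le> pressure p 0"
proof (rule LIMSEQ_le[OF tendsto_const pressure_lim], intro exI[of _ 1] allI impI)
  fix n :: nat assume "n \<ge> 1"
  have "real (2 ^ n) \<le> psum p n 0"
    unfolding psum_0 using card_vals_ge of_nat_le_iff by blast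
  then have "ln (2 ^ n) \<le> ln (psum p n 0)"
    by (subst ln_le_cancel_iff) (use psum_pos in auto)
  then show "ln 2 \<le> ln (psum p n 0) / real n"
    using \<open>n \<ge> 1\<close> by (simp add: ln_realpow field_simps)
qed

section \<open>Lipschitz continuity of the pressure and the root of the pressure equation\<close>

definition pmin :: real where "pmin = Min (p ` alphabet)"

lemma pmin_pos: "0 < pmin"
  unfolding pmin_def by (subst Min_gr_iff) (auto simp: alphabet_def p_pos)

lemma pmin_le: "i \<in> alphabet \<Longrightarrow> pmin \<le> p i"
  unfolding pmin_def by (rule Min_le) (auto simp: alphabet_def)

lemma pmin_power_le_p_word: "w \<in> words n \<Longrightarrow> pmin ^ n \<le> p_word p w"
proof (induction n arbitrary: w)
  case (Suc n)
  then obtain i u where w: "w = i # u" "i \<in> alphabet" "u \<in> words n"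
    by (elim words_SucE)
  have "pmin * pmin ^ n \<le> p i * p_word p u"
    by (intro mult_mono pmin_le w Suc.IH) (use pmin_pos p_pos w in \<open>auto intro: less_imp_le\<close>)
  then show ?case using w by (simp add: p_word_def)
qed (simp add: p_word_def)

lemma pmin_power_le_vweight:
  assumes "N \<in> vals n"
  shows "pmin ^ n \<le> vweight p n N"
proof -
  obtain w where w: "w \<in> words n" "N = val w" using assms by (auto simp: vals_def)
  have "p_word p w \<le> vweight p n N"
    unfolding vweight_def
    by (rule member_le_sum) (use w p_word_pos in \<open>auto intro: less_imp_le\<close>)
  then show ?thesis using pmin_power_le_p_word[OF w(1)] by simp
qed

text \<open>Every level-n weight is at least \<open>pmin ^ n\<close>, so raising the exponent from
  \<open>s\<close> to \<open>t\<close> shrinks each term by at most the factor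
  \<open>(pmin ^ n) powr (t - s)\<close>.\<close>

lemma pressure_diff_le:
  assumes "s \<le> t"
  shows "pressure p s - pressure p t \<le> (t - s) * - ln pmin"
proof -
  have "pressure p s + (t - s) * ln pmin \<le> pressure p t"
  proof (rule LIMSEQ_le[OF tendsto_add[OF pressure_lim tendsto_const] pressure_lim],
      intro exI[of _ 1] allI impI)
    fix n :: nat assume n: "n \<ge> 1"
    have "psum p n s * (pmin ^ n) powr (t - s) \<le> psum p n t"
      unfolding psum_def sum_distrib_right
    proof (rule sum_mono)
      fix N assume N: "N \<in> vals n"
      have "(pmin ^ n) powr (t - s) \<le> vweight p n N powr (t - s)"
        by (rule powr_mono2) (use assms pmin_pos pmin_power_le_vweight[OF N] in auto)
      then have "vweight p n N powr s * (pmin ^ n) powr (t - s) \<le>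
          vweight p n N powr s * vweight p n N powr (t - s)"
        by (rule mult_left_mono) simp
      then show "vweight p n N powr s * (pmin ^ n) powr (t - s) \<le> vweight p n N powr t"
        by (simp flip: powr_add)
    qed
    then have "ln (psum p n s * (pmin ^ n) powr (t - s)) \<le> ln (psum p n t)"
      by (subst ln_le_cancel_iff) (use psum_pos pmin_pos in auto)
    then have "ln (psum p n s) + (t - s) * (real n * ln pmin) \<le> ln (psum p n t)"
      using psum_pos[of n s] pmin_pos by (simp add: ln_mult ln_powr ln_realpow)
    then have "(ln (psum p n s) + (t - s) * (real n * ln pmin)) / real n \<le> ln (psum p n t) / real n"
      by (rule divide_right_mono) simp
    then show "ln (psum p n s) / real n + (t - s) * ln pmin \<le> ln (psum p n t) / real n"
      using n by (simp add: add_divide_distrib)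
  qed
  then show ?thesis by simp
qed

lemma continuous_on_pressure: "continuous_on A (pressure p)"
proof (rule lipschitz_on_continuous_on[of "\<bar>ln pmin\<bar>"], rule lipschitz_onI)
  have *: "\<bar>pressure p x - pressure p y\<bar> \<le> \<bar>ln pmin\<bar> * (y - x)" if "x \<le> y" for x y
  proof -
    have "(y - x) * - ln pmin \<le> (y - x) * \<bar>ln pmin\<bar>"
      by (rule mult_left_mono) (use that in auto)
    then show ?thesis
      using pressure_diff_le[OF that] pressure_antimono[OF that] by (simp add: mult.commute)
  qed
  show "dist (pressure p x) (pressure p y) \<le> \<bar>ln pmin\<bar> * dist x y" for x y
    using *[of x y] *[of y x] by (cases "x \<le> y") (auto simp: dist_real_def abs_minus_commute)
qed simp

text \<open>Existence is the intermediate value theorem: the difference of the two sides is at least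
  \<open>ln 2\<close> at 0 and negative at 1. Uniqueness holds because the pressure is
  non-increasing while \<open>r * t * ln 3\<close> is strictly increasing.\<close>

lemma ex1_pressure_root:
  assumes "0 < r"
  shows "\<exists>!t. pressure_root p r t"
proof (rule ex_ex1I)
  let ?f = "\<lambda>t. pressure p t - r * t * ln 3"
  have "\<exists>t. 0 \<le> t \<and> t \<le> 1 \<and> ?f t = 0"
    by (rule IVT2') (use pressure_0 pressure_1 assms in
      \<open>auto intro!: continuous_intros continuous_on_pressure mult_nonneg_nonneg order_trans[OF _ pressure_0]\<close>)
  then obtain t where t: "0 \<le> t" "t \<le> 1" "?f t = 0" by blast
  have "t \<noteq> 0" using t pressure_0 ln_gt_zero[of 2] by force
  moreover have "t \<noteq> 1" using t pressure_1 assms by auto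
  ultimately show "\<exists>t. pressure_root p r t"
    using t by (auto simp: pressure_root_def intro!: exI[of _ t])
next
  have *: "\<not> s < t" if "pressure_root p r s" "pressure_root p r t" for s t
  proof
    assume "s < t"
    then have "r * s * ln 3 < r * t * ln 3" using assms by simp
    then show False
      using that pressure_antimono[of s t] \<open>s < t\<close> by (simp add: pressure_root_def)
  qed
  show "s = t" if "pressure_root p r s" "pressure_root p r t" for s t
    using *[OF that] *[OF that(2,1)] by simp
qed

end

subsection \<open>The self-similar measure\<close>

locale self_similar = weights +
  fixes \<nu> :: "real measure"
  assumes self_similar: "self_similar_measure p \<nu>"
begin

sublocale prob_space \<nu>
  using self_similar by (simp add: self_similar_measure_def)

lemma sets_nu [simp, measurable_cong]: "sets \<nu> = sets borel"
  using self_similar by (simp add: self_similar_measure_def)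

lemma space_nu [simp]: "space \<nu> = UNIV"
  using sets_eq_imp_space_eq[OF sets_nu] by simp

lemma S_measurable: "S i \<in> borel_measurable borel"
  unfolding S_def[abs_def] by measurable

lemma S_vimage: "A \<in> sets borel \<Longrightarrow> S i -` A \<in> sets borel"
  using measurable_sets[OF S_measurable, of A i] by simp

lemma measure_S:
  assumes "A \<in> sets borel"
  shows "measure \<nu> A = (\<Sum>i\<in>alphabet. p i * measure \<nu> (S i -` A))"
proof -
  have "emeasure \<nu> A = (\<Sum>i\<in>alphabet. ennreal (p i) * emeasure (distr \<nu> borel (S i)) A)"
    using self_similar assms by (simp add: self_similar_measure_def)
  also have "\<dots> = (\<Sum>i\<in>alphabet. ennreal (p i * measure \<nu> (S i -` A)))"
  proof (intro sum.cong refl)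
    fix i assume i: "i \<in> alphabet"
    have "S i \<in> measurable \<nu> borel"
      using S_measurable by (simp add: measurable_cong_sets[OF sets_nu refl])
    then have "emeasure (distr \<nu> borel (S i)) A = emeasure \<nu> (S i -` A)"
      using assms by (simp add: emeasure_distr)
    then show "ennreal (p i) * emeasure (distr \<nu> borel (S i)) A = ennreal (p i * measure \<nu> (S i -` A))"
      using p_pos[OF i] by (simp add: emeasure_eq_measure ennreal_mult)
  qed
  also have "\<dots> = ennreal (\<Sum>i\<in>alphabet. p i * measure \<nu> (S i -` A))"
    by (rule sum_ennreal) (simp add: p_pos less_imp_le)
  finally show ?thesis
    by (simp add: emeasure_eq_measure sum_nonneg p_pos less_imp_le)
qed

lemma measure_S_word:
  "A \<in> sets borel \<Longrightarrow> measure \<nu> A = (\<Sum>w\<in>words n. p_word p w * measure \<nu> (S_word w -` A))"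
proof (induction n arbitrary: A)
  case (Suc n)
  have "measure \<nu> A = (\<Sum>i\<in>alphabet. p i * (\<Sum>w\<in>words n. p_word p w * measure \<nu> (S_word w -` S i -` A)))"
    using measure_S[OF Suc.prems] Suc.IH[OF S_vimage[OF Suc.prems]] by simp
  also have "\<dots> = (\<Sum>w\<in>words (Suc n). p_word p w * measure \<nu> (S_word w -` A))"
    by (simp add: sum_words_Suc sum_distrib_left p_word_def S_word_def vimage_comp mult.assoc)
  finally show ?case .
qed (simp add: p_word_def S_word_def)

text \<open>The iterated self-similarity with overlapping words merged: each distinct level-n map
  occurs once, with its total weight.\<close>

lemma measure_vals:
  assumes "A \<in> sets borel"
  shows "measure \<nu> A =
    (\<Sum>N\<in>vals n. vweight p n N * measure \<nu> ((\<lambda>x. (x + 3 * real N) / 3 ^ n) -` A))"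
proof -
  have "measure \<nu> A = (\<Sum>w\<in>words n. p_word p w *
      measure \<nu> ((\<lambda>x. (x + 3 * real (val w)) / 3 ^ n) -` A))"
    unfolding measure_S_word[OF assms, of n]
    by (intro sum.cong refl) (simp add: S_word_val[abs_def] words_lengthD)
  then show ?thesis
    using sum_words_val[of p "\<lambda>N. measure \<nu> ((\<lambda>x. (x + 3 * real N) / 3 ^ n) -` A)" n] by simp
qed

text \<open>Each \<open>S i\<close> maps the \<open>3 * R\<close>-neighbourhood of [0, 9/2] into its
  \<open>R\<close>-neighbourhood, so the mass does not drop when \<open>R\<close> is replaced by a
  third of it. The neighbourhoods with radii \<open>3 ^ k * R\<close> exhaust the line, hence each
  one has full mass.\<close>

lemma AE_support: "AE x in \<nu>. x \<in> {0..9/2}"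
proof -
  let ?A = "\<lambda>R::real. {-R..9/2 + R}"
  have step: "measure \<nu> (?A (3 * R)) \<le> measure \<nu> (?A R)" if "0 \<le> R" for R
  proof -
    have "measure \<nu> (?A (3 * R)) = (\<Sum>i\<in>alphabet. p i * measure \<nu> (?A (3 * R)))"
      by (simp add: sum_p flip: sum_distrib_right)
    also have "\<dots> \<le> (\<Sum>i\<in>alphabet. p i * measure \<nu> (S i -` ?A R))"
    proof (rule sum_mono)
      fix i assume i: "i \<in> alphabet"
      have "?A (3 * R) \<subseteq> S i -` ?A R"
        using i that by (auto simp: S_def alphabet_def)
      then show "p i * measure \<nu> (?A (3 * R)) \<le> p i * measure \<nu> (S i -` ?A R)"
        by (intro mult_left_mono finite_measure_mono) (use i p_pos in \<open>auto simp: S_vimage less_imp_le\<close>)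
    qed
    also have "\<dots> = measure \<nu> (?A R)" by (rule measure_S[symmetric]) simp
    finally show ?thesis .
  qed
  have one: "measure \<nu> (?A R) = 1" if R: "0 < R" for R
  proof -
    have le: "measure \<nu> (?A (3 ^ k * R)) \<le> measure \<nu> (?A R)" for k
    proof (induction k)
      case (Suc k)
      then show ?case using step[of "3 ^ k * R"] R by (simp add: mult.assoc)
    qed simp
    have "(\<Union>k. ?A (3 ^ k * R)) = UNIV"
    proof -
      have "\<exists>k. x \<in> ?A (3 ^ k * R)" for x
      proof -
        obtain k where "\<bar>x\<bar> / R < 3 ^ k" using real_arch_pow[of 3] by auto
        then have "\<bar>x\<bar> < 3 ^ k * R" using R by (simp add: field_simps)
        then show ?thesis by (intro exI[of _ k]) auto
      qed
      then show ?thesis by blast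
    qed
    moreover have "incseq (\<lambda>k. ?A (3 ^ k * R))"
    proof (rule incseq_SucI)
      fix k show "?A (3 ^ k * R) \<subseteq> ?A (3 ^ Suc k * R)"
        using R by auto
    qed
    ultimately have "(\<lambda>k. measure \<nu> (?A (3 ^ k * R))) \<longlonglongrightarrow> 1"
      using finite_Lim_measure_incseq[of "\<lambda>k. ?A (3 ^ k * R)"] prob_space by (simp add: image_subset_iff)
    then have "1 \<le> measure \<nu> (?A R)"
      by (rule LIMSEQ_le_const2) (use le in auto)
    then show ?thesis by (simp add: measure_ge_1_iff)
  qed
  \<comment> \<open>Countably many radii shrinking to 0 cut the neighbourhoods down to
    [0, 9/2].\<close>
  have "AE x in \<nu>. \<forall>k::nat. x \<in> ?A (inverse (Suc k))"
    unfolding AE_all_countable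
  proof
    fix k :: nat
    show "AE x in \<nu>. x \<in> ?A (inverse (Suc k))"
      using one[of "inverse (Suc k)"] by (subst prob_eq_1[symmetric]) simp_all
  qed
  then show ?thesis
  proof eventually_elim
    case (elim x)
    have "0 \<le> x"
    proof (rule ccontr)
      assume "\<not> 0 \<le> x"
      then obtain k where "inverse (real (Suc k)) < - x" using reals_Archimedean[of "-x"] by auto
      moreover have "x \<in> ?A (inverse (Suc k))" using elim by blast
      ultimately show False by simp
    qed
    moreover have "x \<le> 9/2"
    proof (rule ccontr)
      assume "\<not> x \<le> 9/2"
      then obtain k where "inverse (real (Suc k)) < x - 9/2" using reals_Archimedean[of "x - 9/2"] by auto
      moreover have "x \<in> ?A (inverse (Suc k))" using elim by blast
      ultimately show False by simp
    qed
    ultimately show ?case by simp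
  qed
qed

section \<open>Images of the interval [0, 9/2] (\<open>cyl\<close>) and half-open triadic cells
  (\<open>cell\<close>)\<close>

definition cyl :: "nat \<Rightarrow> nat \<Rightarrow> real set" where
  "cyl n N = {3 * real N / 3 ^ n..(3 * real N + 9/2) / 3 ^ n}"

text \<open>Consecutive images \<open>cyl n N\<close> overlap, whereas the cells of one level are
  disjoint and tile the half-line from 0. They serve the upper bound, the images the lower
  bound.\<close>

definition cell :: "nat \<Rightarrow> nat \<Rightarrow> real set" where
  "cell n N = {3 * real N / 3 ^ n..<3 * (real N + 1) / 3 ^ n}"

lemma cyl_borel [measurable]: "cyl n N \<in> sets borel"
  by (simp add: cyl_def)

lemma cell_borel [measurable]: "cell n N \<in> sets borel"
  by (simp add: cell_def)

text \<open>In \<open>measure_vals\<close> the term of index \<open>N\<close> pulls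
  \<open>cyl n N\<close> back to a set containing [0, 9/2], which has full mass.\<close>

lemma vweight_le_measure_cyl: "vweight p n N \<le> measure \<nu> (cyl n N)"
proof (cases "N \<in> vals n")
  case True
  let ?f = "\<lambda>N x. (x + 3 * real N) / 3 ^ n"
  have [measurable]: "?f M -` cyl n N \<in> sets borel" for M
    using measurable_sets[of "?f M" borel borel "cyl n N"] by simp
  have sub: "{0..9/2} \<subseteq> ?f N -` cyl n N"
    by (auto simp: cyl_def divide_right_mono)
  have "AE x in \<nu>. x \<in> ?f N -` cyl n N"
    using AE_support by eventually_elim (use sub in blast)
  then have "measure \<nu> (?f N -` cyl n N) = 1"
    by (subst prob_eq_1) simp_all
  then have "vweight p n N = vweight p n N * measure \<nu> (?f N -` cyl n N)" by simp
  also have "\<dots> \<le> (\<Sum>M\<in>vals n. vweight p n M * measure \<nu> (?f M -` cyl n N))"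
    by (rule member_le_sum) (use True vweight_nonneg in auto)
  also have "\<dots> = measure \<nu> (cyl n N)"
    by (rule measure_vals[symmetric]) simp
  finally show ?thesis .
qed (simp add: vweight_eq_0)

text \<open>Scaled by \<open>3 ^ n\<close>, the cell is [3N, 3N + 3) and the image of index
  \<open>M\<close> is [3M, 3M + 9/2]; they meet only for \<open>M = N\<close> and
  \<open>M = N - 1\<close>.\<close>

lemma measure_cell_le:
  "measure \<nu> (cell n N) \<le> vweight p n N + (if N = 0 then 0 else vweight p n (N - 1))"
proof -
  let ?f = "\<lambda>N x. (x + 3 * real N) / 3 ^ n"
  \<comment> \<open>The left neighbour is written as \<open>Suc M = N\<close>, so that truncated
    subtraction does not make 0 its own neighbour.\<close>
  let ?w = "\<lambda>M. if M = N \<or> Suc M = N then vweight p n M else 0"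
  have [measurable]: "?f M -` cell n N \<in> sets borel" for M
    using measurable_sets[of "?f M" borel borel "cell n N"] by simp
  have "measure \<nu> (cell n N) = (\<Sum>M\<in>vals n. vweight p n M * measure \<nu> (?f M -` cell n N))"
    by (rule measure_vals) simp
  also have "\<dots> \<le> (\<Sum>M\<in>vals n. ?w M)"
  proof (rule sum_mono)
    fix M
    show "vweight p n M * measure \<nu> (?f M -` cell n N) \<le> ?w M"
    proof (cases "M = N \<or> Suc M = N")
      case True
      then show ?thesis using mult_left_mono[OF prob_le_1 vweight_nonneg] by simp
    next
      case False
      have out: "x \<notin> {0..9/2}" if "x \<in> ?f M -` cell n N" for x
      proof
        assume x: "x \<in> {0..9/2}"
        have "3 * real N \<le> x + 3 * real M" "x + 3 * real M < 3 * (real N + 1)"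
          using that by (auto simp: cell_def divide_le_cancel divide_less_cancel)
        then have "real M < real N + 1" "real N < real M + 2" using x by auto
        then show False using False by linarith
      qed
      have "AE x in \<nu>. x \<notin> ?f M -` cell n N"
        using AE_support by eventually_elim (use out in blast)
      then have "measure \<nu> (?f M -` cell n N) = 0"
        by (subst prob_eq_0) simp_all
      then show ?thesis using False by simp
    qed
  qed
  also have "\<dots> \<le> (\<Sum>M\<in>vals n \<union> {N, N - 1}. ?w M)"
    by (rule sum_mono2) (use vweight_nonneg in auto)
  also have "\<dots> = (\<Sum>M\<in>{N, N - 1}. ?w M)"
    by (rule sum.mono_neutral_right) auto
  also have "\<dots> = vweight p n N + (if N = 0 then 0 else vweight p n (N - 1))"
    by (cases N) auto
  finally show ?thesis .
qed

lemma sum_vweight_powr_le: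
  assumes "finite F"
  shows "(\<Sum>N\<in>F. vweight p n N powr s) \<le> psum p n s"
proof -
  have "(\<Sum>N\<in>F. vweight p n N powr s) = (\<Sum>N\<in>F \<inter> vals n. vweight p n N powr s)"
    by (rule sum.mono_neutral_right) (use assms vweight_eq_0 in auto)
  also have "\<dots> \<le> psum p n s"
    unfolding psum_def by (rule sum_mono2) auto
  finally show ?thesis .
qed

text \<open>By subadditivity of the power \<open>s\<close> the two weights that bound a cell split,
  and each weight is then counted for at most two cells.\<close>

lemma sum_measure_cell_powr_le:
  assumes "0 \<le> s" "s \<le> 1" "finite F"
  shows "(\<Sum>N\<in>F. measure \<nu> (cell n N) powr s) \<le> 2 * psum p n s"
proof -
  have "(\<Sum>N\<in>F. measure \<nu> (cell n N) powr s) \<le>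
      (\<Sum>N\<in>F. vweight p n N powr s + (if N = 0 then 0 else vweight p n (N - 1) powr s))"
  proof (rule sum_mono)
    fix N
    let ?x = "vweight p n N" and ?y = "if N = 0 then 0 else vweight p n (N - 1)"
    have "measure \<nu> (cell n N) powr s \<le> (?x + ?y) powr s"
      by (rule powr_mono2) (use assms measure_cell_le in auto)
    also have "\<dots> \<le> ?x powr s + ?y powr s"
      using sum_powr_le_sum[of "UNIV :: bool set" "\<lambda>b. if b then ?x else ?y" s] assms vweight_nonneg
      by (simp add: UNIV_bool add.commute)
    finally show "measure \<nu> (cell n N) powr s \<le>
        ?x powr s + (if N = 0 then 0 else vweight p n (N - 1) powr s)"
      by (simp split: if_splits)
  qed
  also have "\<dots> = (\<Sum>N\<in>F. vweight p n N powr s) + (\<Sum>N\<in>F - {0}. vweight p n (N - 1) powr s)"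
    using assms by (simp add: sum.distrib sum.If_cases Diff_eq Compl_eq)
  also have "(\<Sum>N\<in>F - {0}. vweight p n (N - 1) powr s) =
      (\<Sum>N\<in>(\<lambda>N. N - 1) ` (F - {0}). vweight p n N powr s)"
    by (subst sum.reindex) (auto simp: inj_on_def)
  also have "(\<Sum>N\<in>F. vweight p n N powr s) + \<dots> \<le> psum p n s + psum p n s"
    by (intro add_mono sum_vweight_powr_le) (use assms in auto)
  finally show ?thesis by simp
qed

subsection \<open>The upper bound\<close>

text \<open>The contraction ratio of a level-n map to the power \<open>r\<close>. A mass times this
  factor is the energy, up to the constant coming from the length of the interval at level
  0.\<close>

definition scale :: "real \<Rightarrow> nat \<Rightarrow> real" where
  "scale r n = (1 / 3 ^ n) powr r"

lemma scale_eq_exp: "scale r n = exp (- (real n * (r * ln 3)))"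
  by (simp add: scale_def powr_def ln_div ln_realpow algebra_simps)

lemma scale_pos: "0 < scale r n"
  by (simp add: scale_eq_exp)

lemma scale_add: "scale r (m + n) = scale r m * scale r n"
  by (simp add: scale_eq_exp algebra_simps flip: exp_add)

lemma scale_tendsto_0:
  assumes "0 < r"
  shows "scale r \<longlonglongrightarrow> 0"
proof -
  have "scale r = (\<lambda>n. exp (- (r * ln 3)) ^ n)"
    by (simp add: scale_eq_exp fun_eq_iff flip: exp_of_nat_mult)
  moreover have "(\<lambda>n. exp (- (r * ln 3)) ^ n) \<longlonglongrightarrow> 0"
    by (rule LIMSEQ_power_zero) (use assms in simp)
  ultimately show ?thesis by simp
qed

text \<open>The strict inequality leaves room for a number \<open>a\<close> in between; eventually
  \<open>psum p n s\<close> is at most \<open>exp (n * a)\<close>, and the terms are dominated by a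
  geometric series of ratio \<open>exp (a - r * s * ln 3)\<close>.\<close>

lemma summable_psum_scale:
  assumes "pressure p s < r * s * ln 3"
  shows "summable (\<lambda>n. psum p n s * scale r n powr s)"
proof -
  obtain a where a: "pressure p s < a" "a < r * s * ln 3"
    using dense[OF assms] by blast
  have ev: "\<forall>\<^sub>F n in sequentially. ln (psum p n s) / real n < a"
    using order_tendstoD(2)[OF pressure_lim a(1)] .
  have "\<forall>\<^sub>F n in sequentially. norm (psum p n s * scale r n powr s) \<le> exp (a - r * s * ln 3) ^ n"
    using ev eventually_ge_at_top[of 1]
  proof eventually_elim
    case (elim n)
    then have "ln (psum p n s) < real n * a" by (simp add: field_simps)
    then have "psum p n s \<le> exp (real n * a)"
      using psum_pos by (metis exp_less_cancel_iff exp_ln less_imp_le)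
    moreover have "scale r n powr s = exp (- (real n * (r * s * ln 3)))"
      by (simp add: scale_eq_exp powr_def algebra_simps)
    ultimately have "psum p n s * scale r n powr s \<le> exp (real n * a) * exp (- (real n * (r * s * ln 3)))"
      by (simp add: mult_right_mono)
    also have "\<dots> = exp (a - r * s * ln 3) ^ n"
      by (simp add: algebra_simps flip: exp_add exp_of_nat_mult)
    finally show ?case using psum_pos[of n s] by simp
  qed
  then show ?thesis
    by (rule summable_comparison_test_ev) (use a in \<open>simp add: summable_geometric\<close>)
qed

section \<open>Descent through the nested triadic cells containing a point\<close>

definition index :: "nat \<Rightarrow> real \<Rightarrow> nat" where
  "index n x = nat \<lfloor>x * 3 ^ n / 3\<rfloor>"

lemma index_bounds:
  assumes "0 \<le> x"
  shows "real (index n x) \<le> x * 3 ^ n / 3" "x * 3 ^ n / 3 < real (index n x) + 1"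
proof -
  have "real (index n x) = of_int \<lfloor>x * 3 ^ n / 3\<rfloor>"
    using assms by (simp add: index_def)
  then show "real (index n x) \<le> x * 3 ^ n / 3" "x * 3 ^ n / 3 < real (index n x) + 1"
    by linarith+
qed

lemma in_cell_index:
  assumes "0 \<le> x"
  shows "x \<in> cell n (index n x)"
  using index_bounds[OF assms, of n] by (simp add: cell_def field_simps)

text \<open>The nesting of the cells: dropping the last base-3 digit of the index leads to the
  parent.\<close>

lemma index_Suc_div_3:
  assumes "0 \<le> x"
  shows "index (Suc n) x div 3 = index n x"
proof -
  have "\<lfloor>x * 3 ^ Suc n / 3\<rfloor> div 3 = \<lfloor>x * 3 ^ n / 3\<rfloor>"
    using floor_divide_real_eq_div[of 3 "x * 3 ^ Suc n / 3"] by simp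
  then show ?thesis
    unfolding index_def using nat_div_distrib[of "\<lfloor>x * 3 ^ Suc n / 3\<rfloor>" 3] assms by simp
qed

lemma index_less:
  assumes "0 \<le> x" "x \<le> 9/2"
  shows "index n x < 2 * 3 ^ n"
proof -
  have "real (index n x) \<le> x * 3 ^ n / 3" by (rule index_bounds) (rule assms)
  also have "\<dots> \<le> (9/2) * 3 ^ n / 3"
    using assms by (intro divide_right_mono mult_right_mono) auto
  also have "\<dots> < 2 * 3 ^ n" by simp
  finally have "real (index n x) < real (2 * 3 ^ n)" by simp
  then show ?thesis by (simp only: of_nat_less_iff)
qed

text \<open>The bound on \<open>N\<close> makes each level finite and, by \<open>index_less\<close>,
  still admits the index of every point of [0, 9/2].\<close>

definition heavy :: "real \<Rightarrow> real \<Rightarrow> (nat \<times> nat) set" where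
  "heavy r \<epsilon> = {(n, N). N < 2 * 3 ^ n \<and> \<epsilon> \<le> measure \<nu> (cell n N) * scale r n}"

text \<open>Masses are at most 1 and the scales tend to 0, so deep levels contain no heavy
  cell.\<close>

lemma heavy_bounded:
  assumes "0 < r" "0 < \<epsilon>"
  obtains K where "heavy r \<epsilon> \<subseteq> (SIGMA n:{..<K}. {..<2 * 3 ^ n})"
proof -
  obtain K where K: "\<And>n. n \<ge> K \<Longrightarrow> scale r n < \<epsilon>"
    using order_tendstoD(2)[OF scale_tendsto_0[OF assms(1)] assms(2)]
    by (auto simp: eventually_sequentially)
  have "n < K" if "(n, N) \<in> heavy r \<epsilon>" for n N
  proof (rule ccontr)
    assume "\<not> n < K"
    then have "scale r n < \<epsilon>" using K by simp
    moreover have "measure \<nu> (cell n N) * scale r n \<le> 1 * scale r n"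
      by (intro mult_right_mono prob_le_1) (simp add: scale_pos less_imp_le)
    ultimately show False using that by (simp add: heavy_def)
  qed
  then have "heavy r \<epsilon> \<subseteq> (SIGMA n:{..<K}. {..<2 * 3 ^ n})"
    by (auto simp: heavy_def)
  then show ?thesis by (rule that)
qed

lemma finite_heavy:
  assumes "0 < r" "0 < \<epsilon>"
  shows "finite (heavy r \<epsilon>)"
proof -
  obtain K where "heavy r \<epsilon> \<subseteq> (SIGMA n:{..<K}. {..<2 * 3 ^ n})"
    using heavy_bounded[OF assms] .
  then show ?thesis by (rule finite_subset) auto
qed

text \<open>A Markov-type count: each heavy cell contributes at least
  \<open>\<epsilon> powr s\<close> to the sum of all energies to the power \<open>s\<close> over all
  levels, and that sum is at most twice the convergent series.\<close>

lemma card_heavy_le: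
  assumes "0 < r" "0 < \<epsilon>" "0 < s" "s \<le> 1"
    and sm: "summable (\<lambda>n. psum p n s * scale r n powr s)"
  shows "card (heavy r \<epsilon>) \<le> 2 * (\<Sum>n. psum p n s * scale r n powr s) * \<epsilon> powr - s"
proof -
  obtain K where K: "heavy r \<epsilon> \<subseteq> (SIGMA n:{..<K}. {..<2 * 3 ^ n})"
    using heavy_bounded[OF assms(1,2)] .
  let ?e = "\<lambda>(n, N). (measure \<nu> (cell n N) * scale r n) powr s"
  have "real (card (heavy r \<epsilon>)) * \<epsilon> powr s = (\<Sum>x\<in>heavy r \<epsilon>. \<epsilon> powr s)" by simp
  also have "\<dots> \<le> (\<Sum>x\<in>heavy r \<epsilon>. ?e x)"
    by (rule sum_mono) (use assms in \<open>auto simp: heavy_def intro!: powr_mono2\<close>)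
  also have "\<dots> \<le> (\<Sum>x\<in>(SIGMA n:{..<K}. {..<2 * 3 ^ n}). ?e x)"
    by (rule sum_mono2) (use K in auto)
  also have "\<dots> = (\<Sum>n<K. \<Sum>N<2 * 3 ^ n. ?e (n, N))"
    by (simp add: sum.Sigma)
  also have "\<dots> = (\<Sum>n<K. (\<Sum>N<2 * 3 ^ n. measure \<nu> (cell n N) powr s) * scale r n powr s)"
    by (simp add: powr_mult scale_pos less_imp_le sum_distrib_right)
  also have "\<dots> \<le> (\<Sum>n<K. (2 * psum p n s) * scale r n powr s)"
    by (intro sum_mono mult_right_mono sum_measure_cell_powr_le) (use assms in auto)
  also have "\<dots> = 2 * (\<Sum>n<K. psum p n s * scale r n powr s)"
    by (simp add: sum_distrib_left mult.assoc)
  also have "\<dots> \<le> 2 * (\<Sum>n. psum p n s * scale r n powr s)"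
    using sum_le_suminf[OF sm, of "{..<K}"] psum_pos by (simp add: less_imp_le)
  finally have "real (card (heavy r \<epsilon>)) * \<epsilon> powr s \<le> 2 * (\<Sum>n. psum p n s * scale r n powr s)" .
  then show ?thesis using assms by (simp add: powr_minus field_simps)
qed

text \<open>The three children of each heavy cell, together with the two cells [0, 3) and [3, 6) of
  level 0, which start the descent. A leaf may itself be heavy; such leaves are discarded in the
  covering.\<close>

definition leaves :: "real \<Rightarrow> real \<Rightarrow> (nat \<times> nat) set" where
  "leaves r \<epsilon> = {0} \<times> {0, 1} \<union> (\<lambda>((n, N), j). (Suc n, 3 * N + j)) ` (heavy r \<epsilon> \<times> {..<3})"

lemma finite_leaves: "0 < r \<Longrightarrow> 0 < \<epsilon> \<Longrightarrow> finite (leaves r \<epsilon>)"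
  by (simp add: leaves_def finite_heavy)

lemma card_leaves_le:
  assumes "0 < r" "0 < \<epsilon>"
  shows "card (leaves r \<epsilon>) \<le> 2 + 3 * card (heavy r \<epsilon>)"
proof -
  have "card (leaves r \<epsilon>) \<le> card ({0::nat} \<times> {0, 1::nat}) +
      card ((\<lambda>((n, N), j). (Suc n, 3 * N + j)) ` (heavy r \<epsilon> \<times> {..<3::nat}))"
    unfolding leaves_def by (rule card_Un_le)
  also have "\<dots> \<le> card ({0::nat} \<times> {0, 1::nat}) + card (heavy r \<epsilon> \<times> {..<3::nat})"
    by (intro add_left_mono card_image_le) (simp add: finite_heavy assms)
  finally show ?thesis by (simp add: card_cartesian_product)
qed

text \<open>Guarantees that a leaf outside \<open>heavy\<close> fails the energy condition and not
  the bound on the index.\<close>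

lemma leaves_less: "(n, N) \<in> leaves r \<epsilon> \<Longrightarrow> N < 2 * 3 ^ n"
  by (auto simp: leaves_def heavy_def)

text \<open>The leaf containing a point is its cell of least level that is not heavy.\<close>

lemma ex_leaf:
  assumes "0 < r" "0 < \<epsilon>" "0 \<le> x" "x \<le> 9/2"
  shows "\<exists>(n, N)\<in>leaves r \<epsilon> - heavy r \<epsilon>. x \<in> cell n N"
proof -
  obtain K where K: "heavy r \<epsilon> \<subseteq> (SIGMA n:{..<K}. {..<2 * 3 ^ n})"
    using heavy_bounded[OF assms(1,2)] .
  define n where "n = (LEAST n. (n, index n x) \<notin> heavy r \<epsilon>)"
  \<comment> \<open>Level \<open>K\<close> has no heavy cell, so the least level in the definition
    of \<open>n\<close> exists.\<close>
  have "(K, index K x) \<notin> heavy r \<epsilon>" using K by auto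
  then have n: "(n, index n x) \<notin> heavy r \<epsilon>" unfolding n_def by (rule LeastI)
  have "(n, index n x) \<in> leaves r \<epsilon>"
  proof (cases n)
    case 0
    have "index 0 x < 2" using index_less[OF assms(3,4), of 0] by simp
    then show ?thesis using 0 by (auto simp: leaves_def)
  next
    case (Suc m)
    then have "m < (LEAST n. (n, index n x) \<notin> heavy r \<epsilon>)" by (simp add: n_def)
    then have "(m, index m x) \<in> heavy r \<epsilon>" using not_less_Least by blast
    moreover have "index n x = 3 * index m x + index n x mod 3"
      unfolding Suc using index_Suc_div_3[OF assms(3), of m] by (metis mult_div_mod_eq)
    ultimately show ?thesis
      unfolding leaves_def Suc
      by (intro UnI2 image_eqI[of _ _ "((m, index m x), index (Suc m) x mod 3)"]) auto
  qed
  then show ?thesis using n in_cell_index[OF assms(3)] by blast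
qed

text \<open>A point of a leaf is within the cell length \<open>3 / 3^n\<close> of the left endpoint.
  Each non-heavy leaf therefore costs at most \<open>3 powr r\<close> times its energy, which is
  below \<open>\<epsilon>\<close>.\<close>

lemma nn_integral_infdist_leaves_le:
  assumes "0 < r" "0 < \<epsilon>"
  defines "\<alpha> \<equiv> (\<lambda>(n, N). 3 * real N / 3 ^ n) ` leaves r \<epsilon>"
  shows "(\<integral>\<^sup>+ x. ennreal (infdist x \<alpha> powr r) \<partial>\<nu>) \<le>
    ennreal (real (card (leaves r \<epsilon>)) * (3 powr r * \<epsilon>))"
proof -
  let ?L = "leaves r \<epsilon> - heavy r \<epsilon>"
  let ?g = "\<lambda>(n, N) x. ennreal (3 powr r * scale r n) * indicator (cell n N) x"
  have fin: "finite ?L" using finite_leaves[OF assms(1,2)] by simp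
  have "(\<integral>\<^sup>+ x. ennreal (infdist x \<alpha> powr r) \<partial>\<nu>) \<le> (\<integral>\<^sup>+ x. (\<Sum>l\<in>?L. ?g l x) \<partial>\<nu>)"
  proof (rule nn_integral_mono_AE, use AE_support in eventually_elim)
    fix x :: real assume x: "x \<in> {0..9/2}"
    then obtain n N where l: "(n, N) \<in> ?L" "x \<in> cell n N"
      using ex_leaf[OF assms(1,2)] by fastforce
    have "3 * real N / 3 ^ n \<in> \<alpha>" using l unfolding \<alpha>_def by force
    then have "infdist x \<alpha> \<le> dist x (3 * real N / 3 ^ n)" by (rule infdist_le)
    also have "\<dots> \<le> 3 * (1 / 3 ^ n)"
      using l by (simp add: cell_def dist_real_def add_divide_distrib distrib_left)
    finally have "infdist x \<alpha> powr r \<le> (3 * (1 / 3 ^ n)) powr r"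
      by (intro powr_mono2) (use assms infdist_nonneg in auto)
    also have "\<dots> = 3 powr r * scale r n"
      unfolding scale_def by (rule powr_mult)
    finally have "ennreal (infdist x \<alpha> powr r) \<le> ?g (n, N) x"
      using l by (simp add: ennreal_leI)
    also have "\<dots> \<le> (\<Sum>l\<in>?L. ?g l x)"
      by (rule member_le_sum) (use l fin in auto)
    finally show "ennreal (infdist x \<alpha> powr r) \<le> (\<Sum>l\<in>?L. ?g l x)" .
  qed
  also have "\<dots> = (\<Sum>l\<in>?L. \<integral>\<^sup>+ x. ?g l x \<partial>\<nu>)"
    by (rule nn_integral_sum) (auto simp: case_prod_unfold)
  also have "\<dots> \<le> (\<Sum>l\<in>?L. ennreal (3 powr r * \<epsilon>))"
  proof (rule sum_mono)
    fix l' assume "l' \<in> ?L"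
    then obtain n N where l: "l' = (n, N)" "(n, N) \<in> leaves r \<epsilon>" "(n, N) \<notin> heavy r \<epsilon>"
      by (cases l') auto
    have "measure \<nu> (cell n N) * scale r n < \<epsilon>"
      using l leaves_less[OF l(2)] by (simp add: heavy_def)
    then have "3 powr r * (scale r n * measure \<nu> (cell n N)) \<le> 3 powr r * \<epsilon>"
      by (simp add: mult.commute)
    then show "(\<integral>\<^sup>+ x. ?g l' x \<partial>\<nu>) \<le> ennreal (3 powr r * \<epsilon>)"
      using scale_pos[of r n] l(1)
      by (simp add: nn_integral_cmult emeasure_eq_measure less_imp_le mult.assoc ennreal_leI flip: ennreal_mult)
  qed
  also have "\<dots> = ennreal (real (card ?L) * (3 powr r * \<epsilon>))"
    using assms by (simp add: ennreal_mult ennreal_of_nat_eq_real_of_nat)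
  also have "\<dots> \<le> ennreal (real (card (leaves r \<epsilon>)) * (3 powr r * \<epsilon>))"
    using assms finite_leaves[OF assms(1,2)]
    by (intro ennreal_leI mult_right_mono) (auto intro!: card_mono)
  finally show ?thesis .
qed

text \<open>With about \<open>\<epsilon> powr - s\<close> leaves available for \<open>k\<close>
  points, the cost is of order \<open>k * \<epsilon>\<close> with \<open>\<epsilon>\<close> of order
  \<open>k powr (- 1 / s)\<close>; the exponent is \<open>1 - 1 / s = - (1 - s) / s\<close>.\<close>

lemma quant_V_upper:
  assumes "0 < r" "0 < s" "s < 1" "pressure p s < r * s * ln 3"
  shows "\<exists>C>0. \<forall>\<^sub>F k in sequentially.
    quant_V k r \<nu> \<le> ennreal (C * real k powr (- (1 - s) / s))"
proof -
  \<comment> \<open>Two cells of level 0, plus three children for each of the heavy cells counted by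
    \<open>card_heavy_le\<close>.\<close>
  define D where "D = 2 + 3 * (2 * (\<Sum>n. psum p n s * scale r n powr s))"
  note sm = summable_psum_scale[OF assms(4)]
  have D: "2 \<le> D"
    unfolding D_def using suminf_nonneg[OF sm] psum_pos by (simp add: less_imp_le)
  have card: "real (card (leaves r \<epsilon>)) \<le> D * \<epsilon> powr - s" if \<epsilon>: "0 < \<epsilon>" "\<epsilon> \<le> 1" for \<epsilon>
  proof -
    have "real (card (leaves r \<epsilon>)) \<le> 2 + 3 * real (card (heavy r \<epsilon>))"
      using card_leaves_le[OF assms(1) \<epsilon>(1)] by linarith
    also have "\<dots> \<le> 2 * \<epsilon> powr - s + 3 * (2 * (\<Sum>n. psum p n s * scale r n powr s) * \<epsilon> powr - s)"
    proof (intro add_mono mult_left_mono)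
      have "1 powr - s \<le> \<epsilon> powr - s"
        using \<epsilon> assms by (intro powr_mono2') auto
      then show "2 \<le> 2 * \<epsilon> powr - s" by simp
      show "real (card (heavy r \<epsilon>)) \<le> 2 * (\<Sum>n. psum p n s * scale r n powr s) * \<epsilon> powr - s"
        by (rule card_heavy_le) (use assms \<epsilon> sm in auto)
    qed simp
    finally show ?thesis by (simp add: D_def algebra_simps)
  qed
  define C where "C = 3 powr r * D powr (1 / s)"
  have "quant_V k r \<nu> \<le> ennreal (C * real k powr (- (1 - s) / s))" if k: "D \<le> real k" for k
  proof -
    \<comment> \<open>The solution of \<open>D * \<epsilon> powr - s = k\<close>; it is at most 1
      because \<open>D \<le> k\<close>.\<close>
    define \<epsilon> where "\<epsilon> = (real k / D) powr (- 1 / s)"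
    have kD: "1 \<le> real k / D" using k D by simp
    have \<epsilon>: "0 < \<epsilon>" "\<epsilon> \<le> 1"
      using kD assms D powr_mono2'[of "- 1 / s" 1 "real k / D"] by (auto simp: \<epsilon>_def)
    have \<epsilon>s: "\<epsilon> powr - s = real k / D"
      using kD D assms by (simp add: \<epsilon>_def powr_powr)
    let ?\<alpha> = "(\<lambda>(n, N). 3 * real N / 3 ^ n) ` leaves r \<epsilon>"
    have fin: "finite (leaves r \<epsilon>)" using finite_leaves assms \<epsilon> by blast
    have cl: "real (card (leaves r \<epsilon>)) \<le> real k"
      using card[OF \<epsilon>] D \<epsilon>s by simp
    then have "card ?\<alpha> \<le> k"
      using card_image_le[OF fin, of "\<lambda>(n, N). 3 * real N / 3 ^ n"] by simp
    moreover have "?\<alpha> \<noteq> {}" by (auto simp: leaves_def)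
    then have "1 \<le> card ?\<alpha>" using fin by (simp add: Suc_le_eq card_gt_0_iff)
    ultimately have "quant_V k r \<nu> \<le> (\<integral>\<^sup>+ x. ennreal (infdist x ?\<alpha> powr r) \<partial>\<nu>)"
      unfolding quant_V_def using fin by (intro INF_lower) auto
    also have "\<dots> \<le> ennreal (real (card (leaves r \<epsilon>)) * (3 powr r * \<epsilon>))"
      by (rule nn_integral_infdist_leaves_le) (use assms \<epsilon> in auto)
    also have "\<dots> \<le> ennreal (real k * (3 powr r * \<epsilon>))"
      using cl \<epsilon> by (intro ennreal_leI mult_right_mono) auto
    also have "real k * (3 powr r * \<epsilon>) = C * real k powr (- (1 - s) / s)"
    proof -
      have "real k powr (- (1 - s) / s) = real k powr (1 + - 1 / s)"
        using assms by (simp add: field_simps)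
      also have "\<dots> = real k * real k powr (- 1 / s)"
        unfolding powr_add using k D by simp
      finally show ?thesis
        using D k by (simp add: C_def \<epsilon>_def powr_divide powr_minus field_simps)
    qed
    finally show ?thesis .
  qed
  then have "\<forall>\<^sub>F k in sequentially. quant_V k r \<nu> \<le> ennreal (C * real k powr (- (1 - s) / s))"
    by (intro eventually_mono[OF eventually_ge_at_top[of "nat \<lceil>D\<rceil>"]]) (auto simp: nat_le_iff ceiling_le_iff)
  moreover have "0 < C" using D by (simp add: C_def)
  ultimately show ?thesis by blast
qed

subsection \<open>The lower bound\<close>

text \<open>Only the level of the first interval enters the gap, but pairs are taken in both orders,
  so the gap is governed by the coarser of the two. The constant is what remains of 6 after
  subtracting the length 9/2 when two indices differ by at least 2.\<close>

definition separated :: "(nat \<times> nat) set \<Rightarrow> bool" where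
  "separated \<Gamma> \<longleftrightarrow> (\<forall>n N n' N'. (n, N) \<in> \<Gamma> \<longrightarrow> (n', N') \<in> \<Gamma> \<longrightarrow> (n, N) \<noteq> (n', N') \<longrightarrow>
     (\<forall>x\<in>cyl n N. \<forall>y\<in>cyl n' N'. 3 / 2 * (1 / 3 ^ n) \<le> \<bar>x - y\<bar>))"

lemma separatedD:
  "\<lbrakk>separated \<Gamma>; (n, N) \<in> \<Gamma>; (n', N') \<in> \<Gamma>; (n, N) \<noteq> (n', N'); x \<in> cyl n N; y \<in> cyl n' N'\<rbrakk>
    \<Longrightarrow> 3 / 2 * (1 / 3 ^ n) \<le> \<bar>x - y\<bar>"
  unfolding separated_def by blast

lemma cyl_iff: "x \<in> cyl n N \<longleftrightarrow> 3 * real N \<le> x * 3 ^ n \<and> x * 3 ^ n \<le> 3 * real N + 9/2"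
proof -
  have "3 * real N / 3 ^ n \<le> x \<longleftrightarrow> 3 * real N \<le> x * 3 ^ n" by (rule pos_divide_le_eq) simp
  moreover have "x \<le> (3 * real N + 9/2) / 3 ^ n \<longleftrightarrow> x * 3 ^ n \<le> 3 * real N + 9/2"
    by (rule pos_le_divide_eq) simp
  ultimately show ?thesis unfolding cyl_def atLeastAtMost_iff by blast
qed

text \<open>The map \<open>x * 3 ^ m - 3 * A\<close> inverts the level-m map of value
  \<open>A\<close>, so the images inside it are copies of the original ones.\<close>

lemma cyl_add_iff: "x \<in> cyl (m + n) (A * 3 ^ n + N) \<longleftrightarrow> x * 3 ^ m - 3 * real A \<in> cyl n N"
proof -
  have "(x * 3 ^ m - 3 * real A) * 3 ^ n = x * 3 ^ (m + n) - 3 * (real A * 3 ^ n)"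
    by (simp add: power_add algebra_simps)
  then show ?thesis unfolding cyl_iff by auto
qed

lemma cyl_subset:
  assumes "N \<in> vals n"
  shows "cyl n N \<subseteq> {0..9/2}"
proof -
  have "real (2 * N + 3) \<le> real (3 * 3 ^ n)"
    using vals_bound[OF assms] by (rule of_nat_mono)
  then have "(3 * real N + 9/2) / 3 ^ n \<le> 9/2" by (simp add: field_simps)
  moreover have "0 \<le> 3 * real N / 3 ^ n" by simp
  ultimately show ?thesis unfolding cyl_def by (metis atLeastatMost_subset_iff)
qed

text \<open>The maps of level \<open>m\<close> indexed by \<open>G\<close> form an iterated function system with disjoint
  images of \<open>[0, 9/2]\<close>. The family is built by recursion on the first map \<open>A \<in> G\<close>, applied
  to a family for the threshold \<open>\<epsilon>\<close> divided by the energy of \<open>A\<close>.\<close>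

lemma ex_separated_family:
  assumes "0 < r" "1 \<le> m" "0 < s" and G: "G \<subseteq> vals m"
    and spaced: "\<And>A B. A \<in> G \<Longrightarrow> B \<in> G \<Longrightarrow> A < B \<Longrightarrow> A + 2 \<le> B"
    and large: "1 \<le> (\<Sum>A\<in>G. (vweight p m A * scale r m) powr s)"
  shows "\<exists>c>0. \<forall>\<epsilon>. 0 < \<epsilon> \<and> \<epsilon> \<le> 1 \<longrightarrow> (\<exists>\<Gamma>. finite \<Gamma> \<and> separated \<Gamma> \<and> \<epsilon> powr - s \<le> card \<Gamma> \<and>
    (\<forall>n N. (n, N) \<in> \<Gamma> \<longrightarrow> N \<in> vals n \<and> c * \<epsilon> \<le> vweight p n N * scale r n))"
proof -
  let ?e = "\<lambda>A. vweight p m A * scale r m"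
  define c where "c = Min (?e ` G)"
  define \<rho> where "\<rho> = scale r m"
  have fin: "finite G" using finite_subset[OF G] by simp
  have "G \<noteq> {}" using large by auto
  then obtain A0 where A0: "A0 \<in> G" by blast
  have e_pos: "0 < ?e A" if "A \<in> G" for A
    using that G by (intro mult_pos_pos vweight_pos scale_pos) blast
  have c_pos: "0 < c"
    unfolding c_def using fin \<open>G \<noteq> {}\<close> e_pos by (subst Min_gr_iff) auto
  have c_le: "c \<le> ?e A" if "A \<in> G" for A
    unfolding c_def using fin that by (intro Min_le) auto
  have e_le: "?e A \<le> \<rho>" for A
    unfolding \<rho>_def using mult_right_mono[OF vweight_le_1, of "scale r m"] scale_pos
    by (simp add: less_imp_le)
  have \<rho>: "0 < \<rho>" "\<rho> < 1"
    using assms by (auto simp: \<rho>_def scale_eq_exp)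
  have c1: "c \<le> 1" using c_le[OF A0] e_le[of A0] \<rho> by simp
  let ?P = "\<lambda>\<epsilon> \<Gamma>. finite \<Gamma> \<and> separated \<Gamma> \<and> \<epsilon> powr - s \<le> card \<Gamma> \<and>
    (\<forall>n N. (n, N) \<in> \<Gamma> \<longrightarrow> N \<in> vals n \<and> c * \<epsilon> \<le> vweight p n N * scale r n)"
  \<comment> \<open>For a threshold of at least 1 the level-0 interval alone suffices: its energy is
    1, and \<open>\<epsilon> powr - s\<close> is at most 1.\<close>
  have base: "\<exists>\<Gamma>. ?P \<epsilon> \<Gamma>" if "1 \<le> \<epsilon>" "\<epsilon> \<le> 1 / c" for \<epsilon>
  proof (intro exI[of _ "{(0, 0)}"] conjI)
    have "\<epsilon> powr - s \<le> 1 powr - s" using that assms by (intro powr_mono2') auto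
    then show "\<epsilon> powr - s \<le> card {(0::nat, 0::nat)}" by simp
    have "c * \<epsilon> \<le> 1" using that c_pos by (simp add: field_simps)
    moreover have "vweight p 0 0 * scale r 0 = 1" "(0::nat) \<in> vals 0"
      using sum_vweight[of 0] by (simp_all add: vals_def scale_def)
    ultimately show "\<forall>n N. (n, N) \<in> {(0, 0)} \<longrightarrow> N \<in> vals n \<and> c * \<epsilon> \<le> vweight p n N * scale r n"
      by simp
  qed (auto simp: separated_def)
  \<comment> \<open>Passing from \<epsilon> to \<epsilon> divided by the energy of a map gains a
    factor \<open>\<rho>\<close> in the lower bound. It may push the threshold above 1, but for
    \<open>\<epsilon> < 1\<close> never above \<open>1 / c\<close>, which is why thresholds up to
    \<open>1 / c\<close> are included.\<close>
  have main: "\<exists>\<Gamma>. ?P \<epsilon> \<Gamma>" if "\<rho> ^ k \<le> \<epsilon>" "\<epsilon> \<le> 1 / c" for k \<epsilon>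
    using that
  proof (induction k arbitrary: \<epsilon>)
    case 0
    then show ?case using base by simp
  next
    case (Suc k)
    show ?case
    proof (cases "1 \<le> \<epsilon>")
      case True
      then show ?thesis using base Suc.prems by blast
    next
      case False
      have \<epsilon>: "0 < \<epsilon>" using Suc.prems(1) \<rho> by (meson less_le_trans zero_less_power)
      have "\<exists>\<Gamma>. ?P (\<epsilon> / ?e A) \<Gamma>" if A: "A \<in> G" for A
      proof (rule Suc.IH)
        have "\<rho> ^ k * ?e A \<le> \<rho> ^ k * \<rho>"
          by (intro mult_left_mono e_le) (use \<rho> in simp)
        also have "\<dots> \<le> \<epsilon>" using Suc.prems(1) by (simp add: mult.commute)
        finally show "\<rho> ^ k \<le> \<epsilon> / ?e A"
          by (subst pos_le_divide_eq[OF e_pos[OF A]])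
        show "\<epsilon> / ?e A \<le> 1 / c"
          by (rule frac_le) (use False c_pos c_le[OF A] in auto)
      qed
      then obtain \<Gamma> where \<Gamma>: "\<And>A. A \<in> G \<Longrightarrow> ?P (\<epsilon> / ?e A) (\<Gamma> A)"
        by metis
      define f where "f = (\<lambda>(A, n, N). (m + n, A * 3 ^ n + N :: nat))"
      let ?\<Gamma> = "f ` Sigma G \<Gamma>"
      have vals: "N \<in> vals n" if "A \<in> G" "(n, N) \<in> \<Gamma> A" for A n N
        using \<Gamma>[OF that(1)] that(2) by blast
      have sep: "3 / 2 * (1 / 3 ^ (m + n)) \<le> \<bar>x - y\<bar>"
        if "A \<in> G" "(n, N) \<in> \<Gamma> A" "B \<in> G" "(n', N') \<in> \<Gamma> B" "(A, n, N) \<noteq> (B, n', N')"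
          "x \<in> cyl (m + n) (A * 3 ^ n + N)" "y \<in> cyl (m + n') (B * 3 ^ n' + N')"
        for A B n n' N N' x y
      proof -
        let ?x = "x * 3 ^ m - 3 * real A" and ?y = "y * 3 ^ m - 3 * real B"
        have xy: "?x \<in> cyl n N" "?y \<in> cyl n' N'" using that by (simp_all add: cyl_add_iff)
        have "3 / 2 * (1 / 3 ^ n) \<le> \<bar>x * 3 ^ m - y * 3 ^ m\<bar>"
        proof (cases "A = B")
          case True
          then have "(n, N) \<noteq> (n', N')" "(n', N') \<in> \<Gamma> A" using that by auto
          then have "3 / 2 * (1 / 3 ^ n) \<le> \<bar>?x - ?y\<bar>"
            using \<Gamma>[OF that(1)] that(2) xy by (intro separatedD) auto
          then show ?thesis using True by simp
        next
          case False
          then have "A + 2 \<le> B \<or> B + 2 \<le> A"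
            using spaced that by (metis linorder_neqE_nat)
          then have "real A + 2 \<le> real B \<or> real B + 2 \<le> real A" by linarith
          moreover have "?x \<in> {0..9/2}" "?y \<in> {0..9/2}"
            using xy cyl_subset vals that by blast+
          \<comment> \<open>After scaling by \<open>3 ^ m\<close> the two images start at least 6
            apart and have length 9/2.\<close>
          ultimately have "3 / 2 \<le> \<bar>x * 3 ^ m - y * 3 ^ m\<bar>"
            unfolding atLeastAtMost_iff by linarith
          moreover have "1 / 3 ^ n \<le> (1::real)" by simp
          ultimately show ?thesis by linarith
        qed
        also have "\<dots> = \<bar>x - y\<bar> * 3 ^ m"
          by (simp add: abs_mult flip: left_diff_distrib)
        finally show ?thesis by (simp add: power_add field_simps)
      qed
      have inj: "inj_on f (Sigma G \<Gamma>)"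
      proof (rule inj_onI)
        fix a b assume ab: "a \<in> Sigma G \<Gamma>" "b \<in> Sigma G \<Gamma>" "f a = f b"
        obtain A n N B n' N' where eq: "a = (A, n, N)" "b = (B, n', N')"
          by (metis prod.exhaust)
        \<comment> \<open>The left endpoint common to both images: for distinct triples, separation
          would put it at a positive distance from itself.\<close>
        let ?x = "3 * real (A * 3 ^ n + N) / 3 ^ (m + n)"
        have "?x \<in> cyl (m + n) (A * 3 ^ n + N)"
          unfolding cyl_def by (simp add: divide_right_mono)
        moreover have n: "n' = n" and N: "A * 3 ^ n + N = B * 3 ^ n + N'"
          using ab(3) by (auto simp: eq f_def)
        ultimately have "?x \<in> cyl (m + n) (A * 3 ^ n + N)" "?x \<in> cyl (m + n') (B * 3 ^ n' + N')"
          by simp_all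
        moreover have "\<not> 3 / 2 * (1 / 3 ^ (m + n)) \<le> \<bar>?x - ?x\<bar>" by (simp add: not_le)
        ultimately show "a = b"
          using sep[of A n N B n' N' ?x ?x] ab(1,2) unfolding eq by blast
      qed
      have "?P \<epsilon> ?\<Gamma>"
      proof (intro conjI)
        show "finite ?\<Gamma>" using fin \<Gamma> by auto
        show "separated ?\<Gamma>"
          unfolding separated_def
        proof (intro allI impI ballI)
          fix k K k' K' x y
          assume k: "(k, K) \<in> ?\<Gamma>" "(k', K') \<in> ?\<Gamma>" "(k, K) \<noteq> (k', K')"
            and xy: "x \<in> cyl k K" "y \<in> cyl k' K'"
          obtain A n N where A: "A \<in> G" "(n, N) \<in> \<Gamma> A" "k = m + n" "K = A * 3 ^ n + N"
            using k(1) by (auto simp: f_def)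
          obtain B n' N' where B: "B \<in> G" "(n', N') \<in> \<Gamma> B" "k' = m + n'" "K' = B * 3 ^ n' + N'"
            using k(2) by (auto simp: f_def)
          show "3 / 2 * (1 / 3 ^ k) \<le> \<bar>x - y\<bar>"
            unfolding A(3) by (rule sep[OF A(1,2) B(1,2)]) (use k(3) xy A B in auto)
        qed
        \<comment> \<open>The count propagates because the thresholds were divided by the energies:
          each subfamily has at least \<open>\<epsilon> powr - s\<close> times the energy of
          \<open>A\<close> to the power \<open>s\<close> members, and these powers sum to at least
          1.\<close>
        have "\<epsilon> powr - s \<le> \<epsilon> powr - s * (\<Sum>A\<in>G. ?e A powr s)"
          using mult_left_mono[OF large, of "\<epsilon> powr - s"] by simp
        also have "\<dots> = (\<Sum>A\<in>G. (\<epsilon> / ?e A) powr - s)"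
          unfolding sum_distrib_left
          by (intro sum.cong refl) (use \<epsilon> e_pos in \<open>simp add: powr_divide powr_minus field_simps\<close>)
        also have "\<dots> \<le> (\<Sum>A\<in>G. real (card (\<Gamma> A)))"
          by (rule sum_mono) (use \<Gamma> in blast)
        also have "\<dots> = real (card (Sigma G \<Gamma>))"
          using fin \<Gamma> by (simp add: card_SigmaI)
        also have "\<dots> = real (card ?\<Gamma>)"
          by (simp add: card_image[OF inj])
        finally show "\<epsilon> powr - s \<le> real (card ?\<Gamma>)" .
        have "A * 3 ^ n + N \<in> vals (m + n) \<and>
            c * \<epsilon> \<le> vweight p (m + n) (A * 3 ^ n + N) * scale r (m + n)"
          if A: "A \<in> G" and N: "(n, N) \<in> \<Gamma> A" for A n N
        proof
          show "A * 3 ^ n + N \<in> vals (m + n)"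
            unfolding vals_add using A G vals[OF A N] by force
          have "c * (\<epsilon> / ?e A) \<le> vweight p n N * scale r n"
            using \<Gamma>[OF A] N by blast
          then have "c * \<epsilon> \<le> (vweight p m A * vweight p n N) * scale r (m + n)"
            using e_pos[OF A] by (simp add: pos_divide_le_eq scale_add mult_ac)
          also have "\<dots> \<le> vweight p (m + n) (A * 3 ^ n + N) * scale r (m + n)"
            by (intro mult_right_mono vweight_mult_le) (use A G vals[OF A N] scale_pos in \<open>auto intro: less_imp_le\<close>)
          finally show "c * \<epsilon> \<le> vweight p (m + n) (A * 3 ^ n + N) * scale r (m + n)" .
        qed
        then show "\<forall>n N. (n, N) \<in> ?\<Gamma> \<longrightarrow> N \<in> vals n \<and> c * \<epsilon> \<le> vweight p n N * scale r n"
          by (auto simp: f_def)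
      qed
      then show ?thesis by blast
    qed
  qed
  have "\<exists>\<Gamma>. ?P \<epsilon> \<Gamma>" if \<epsilon>: "0 < \<epsilon>" "\<epsilon> \<le> 1" for \<epsilon>
  proof -
    obtain k where "\<rho> ^ k < \<epsilon>" using real_arch_pow_inv[OF \<epsilon>(1) \<rho>(2)] by blast
    moreover have "1 \<le> 1 / c" using c1 c_pos by simp
    ultimately show ?thesis using main[of k \<epsilon>] \<epsilon> by simp
  qed
  then show ?thesis using c_pos by blast
qed

text \<open>At a sufficiently deep level the energies to the power \<open>s\<close> sum to at least
  2, so the even or the odd values carry at least 1; values of equal parity differ by at least
  2.\<close>

lemma ex_spaced_subset:
  assumes "0 < r" "0 < s" "r * s * ln 3 < pressure p s"
  obtains m G where "1 \<le> m" "G \<subseteq> vals m"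
    "\<And>A B. A \<in> G \<Longrightarrow> B \<in> G \<Longrightarrow> A < B \<Longrightarrow> A + 2 \<le> B"
    "1 \<le> (\<Sum>A\<in>G. (vweight p m A * scale r m) powr s)"
proof -
  obtain a where a: "r * s * ln 3 < a" "a < pressure p s"
    using dense[OF assms(3)] by blast
  define \<delta> where "\<delta> = a - r * s * ln 3"
  have \<delta>: "0 < \<delta>" using a by (simp add: \<delta>_def)
  have "filterlim (\<lambda>n. real n * \<delta>) at_top sequentially"
    by (rule filterlim_at_top_mult_tendsto_pos[OF tendsto_const \<delta> filterlim_real_sequentially])
  then have "\<forall>\<^sub>F n in sequentially. ln 2 \<le> real n * \<delta>"
    by (simp add: filterlim_at_top)
  moreover have "\<forall>\<^sub>F n in sequentially. a < ln (psum p n s) / real n"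
    using order_tendstoD(1)[OF pressure_lim a(2)] .
  ultimately have "\<forall>\<^sub>F n in sequentially. ln 2 \<le> real n * \<delta> \<and> a < ln (psum p n s) / real n \<and> 1 \<le> n"
    by (intro eventually_conj eventually_ge_at_top)
  then obtain m where m: "ln 2 \<le> real m * \<delta>" "a < ln (psum p m s) / real m" "1 \<le> m"
    by (auto simp: eventually_sequentially)
  let ?f = "\<lambda>A. (vweight p m A * scale r m) powr s"
  have "real m * a < ln (psum p m s)" using m by (simp add: field_simps)
  then have "exp (real m * a) \<le> psum p m s"
    using psum_pos by (metis exp_less_cancel_iff exp_ln less_imp_le)
  moreover have "scale r m powr s = exp (- (real m * (r * s * ln 3)))"
    by (simp add: scale_eq_exp powr_def algebra_simps)
  ultimately have "exp (real m * a) * exp (- (real m * (r * s * ln 3))) \<le> psum p m s * scale r m powr s"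
    by (simp add: mult_right_mono)
  then have "exp (real m * \<delta>) \<le> psum p m s * scale r m powr s"
    by (simp add: \<delta>_def algebra_simps flip: exp_add)
  moreover have "exp (ln 2) \<le> exp (real m * \<delta>)" using m(1) by (simp only: exp_le_cancel_iff)
  ultimately have "2 \<le> psum p m s * scale r m powr s" by simp
  also have "\<dots> = (\<Sum>A\<in>vals m. ?f A)"
    unfolding psum_def sum_distrib_right
    by (intro sum.cong refl) (simp add: powr_mult)
  also have "\<dots> = (\<Sum>A\<in>{A \<in> vals m. even A}. ?f A) + (\<Sum>A\<in>{A \<in> vals m. odd A}. ?f A)"
    by (subst sum.union_disjoint[symmetric]) (auto intro!: sum.cong)
  finally consider "1 \<le> (\<Sum>A\<in>{A \<in> vals m. even A}. ?f A)" | "1 \<le> (\<Sum>A\<in>{A \<in> vals m. odd A}. ?f A)"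
    by linarith
  then show ?thesis
  proof cases
    case 1
    show ?thesis
    proof (rule that[OF m(3) _ _ 1])
      show "A + 2 \<le> B" if "A \<in> {A \<in> vals m. even A}" "B \<in> {A \<in> vals m. even A}" "A < B" for A B
        proof -
        have "even A" "even B" using that by auto
        then show ?thesis using \<open>A < B\<close> by presburger
      qed
    qed auto
  next
    case 2
    show ?thesis
    proof (rule that[OF m(3) _ _ 2])
      show "A + 2 \<le> B" if "A \<in> {A \<in> vals m. odd A}" "B \<in> {A \<in> vals m. odd A}" "A < B" for A B
        proof -
        have "odd A" "odd B" using that by auto
        then show ?thesis using \<open>A < B\<close> by presburger
      qed
    qed auto
  qed
qed

text \<open>A quantizing point is near at most one interval of the family, so at least
  \<open>card \<Gamma> - card \<alpha>\<close> of them have no near point. On each of these the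
  distance is at least \<open>3 / 4 * (1 / 3 ^ n)\<close>, and disjointness lets the integrals be
  added.\<close>

lemma separated_nn_integral_ge:
  assumes r: "0 < r" and \<Gamma>: "finite \<Gamma>" "separated \<Gamma>"
    and energy: "\<And>n N. (n, N) \<in> \<Gamma> \<Longrightarrow> b \<le> vweight p n N * scale r n" and "0 \<le> b"
    and \<alpha>: "finite \<alpha>" "\<alpha> \<noteq> {}"
  shows "ennreal (real (card \<Gamma> - card \<alpha>) * ((3 / 4) powr r * b)) \<le>
    (\<integral>\<^sup>+ x. ennreal (infdist x \<alpha> powr r) \<partial>\<nu>)"
proof -
  define near where "near = (\<lambda>(n, N) a. \<exists>x\<in>cyl n N. \<bar>x - a\<bar> < 3 / 4 * (1 / 3 ^ n))"
  define H where "H = {g \<in> \<Gamma>. \<exists>a\<in>\<alpha>. near g a}"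
  have "\<forall>g\<in>H. \<exists>a. a \<in> \<alpha> \<and> near g a" unfolding H_def by blast
  then obtain h where h: "\<And>g. g \<in> H \<Longrightarrow> h g \<in> \<alpha> \<and> near g (h g)" by metis
  have "inj_on h H"
  proof (rule inj_onI, rule ccontr)
    fix g g' assume g: "g \<in> H" "g' \<in> H" "h g = h g'" "g \<noteq> g'"
    obtain n N n' N' where eq: "g = (n, N)" "g' = (n', N')" by (metis prod.exhaust)
    obtain x where x: "x \<in> cyl n N" "\<bar>x - h g\<bar> < 3 / 4 * (1 / 3 ^ n)"
      using h[OF g(1)] eq by (auto simp: near_def)
    obtain y where y: "y \<in> cyl n' N'" "\<bar>y - h g\<bar> < 3 / 4 * (1 / 3 ^ n')"
      using h[OF g(2)] g(3) eq by (auto simp: near_def)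
    \<comment> \<open>Averaging the two gaps gives \<open>\<bar>x - y\<bar>\<close> at least 3/4 of
      the sum of both scales, against the triangle inequality through the common point
      \<open>h g\<close>.\<close>
    have "3 / 2 * (1 / 3 ^ n) \<le> \<bar>x - y\<bar>" "3 / 2 * (1 / 3 ^ n') \<le> \<bar>y - x\<bar>"
      using separatedD[OF \<Gamma>(2)] g eq x y by (auto simp: H_def)
    then show False using x(2) y(2) by linarith
  qed
  then have "card H \<le> card \<alpha>"
    using h \<alpha> by (intro card_inj_on_le[of h]) auto
  moreover have "card (\<Gamma> - H) = card \<Gamma> - card H"
    using \<Gamma> by (intro card_Diff_subset) (auto simp: H_def intro: finite_subset[of _ \<Gamma>])
  ultimately have card: "card \<Gamma> - card \<alpha> \<le> card (\<Gamma> - H)" by simp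
  let ?g = "\<lambda>(n, N) x. ennreal ((3 / 4) powr r * scale r n) * indicator (cyl n N) x"
  have "ennreal (real (card \<Gamma> - card \<alpha>) * ((3 / 4) powr r * b)) \<le>
      ennreal (real (card (\<Gamma> - H)) * ((3 / 4) powr r * b))"
    using card \<open>0 \<le> b\<close> by (intro ennreal_leI mult_right_mono) auto
  also have "\<dots> = (\<Sum>l\<in>\<Gamma> - H. ennreal ((3 / 4) powr r * b))"
    using \<open>0 \<le> b\<close> by (simp add: ennreal_mult ennreal_of_nat_eq_real_of_nat)
  also have "\<dots> \<le> (\<Sum>l\<in>\<Gamma> - H. \<integral>\<^sup>+ x. ?g l x \<partial>\<nu>)"
  proof (rule sum_mono)
    fix l assume "l \<in> \<Gamma> - H"
    then obtain n N where l: "l = (n, N)" "(n, N) \<in> \<Gamma>" by (cases l) auto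
    have "b \<le> vweight p n N * scale r n" by (rule energy[OF l(2)])
    also have "\<dots> \<le> measure \<nu> (cyl n N) * scale r n"
      by (intro mult_right_mono vweight_le_measure_cyl) (simp add: scale_pos less_imp_le)
    finally have "(3 / 4) powr r * b \<le> (3 / 4) powr r * (scale r n * measure \<nu> (cyl n N))"
      by (simp add: mult.commute)
    then show "ennreal ((3 / 4) powr r * b) \<le> (\<integral>\<^sup>+ x. ?g l x \<partial>\<nu>)"
      using scale_pos[of r n] l(1)
      by (simp add: nn_integral_cmult emeasure_eq_measure less_imp_le mult.assoc ennreal_leI flip: ennreal_mult)
  qed
  also have "\<dots> = (\<integral>\<^sup>+ x. (\<Sum>l\<in>\<Gamma> - H. ?g l x) \<partial>\<nu>)"
    by (rule nn_integral_sum[symmetric]) (auto simp: case_prod_unfold)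
  also have "\<dots> \<le> (\<integral>\<^sup>+ x. ennreal (infdist x \<alpha> powr r) \<partial>\<nu>)"
  proof (rule nn_integral_mono)
    fix x
    show "(\<Sum>l\<in>\<Gamma> - H. ?g l x) \<le> ennreal (infdist x \<alpha> powr r)"
    proof (cases "\<exists>n N. (n, N) \<in> \<Gamma> - H \<and> x \<in> cyl n N")
      case False
      have "(\<Sum>l\<in>\<Gamma> - H. ?g l x) = 0"
      proof (rule sum.neutral, rule ballI)
        fix l assume "l \<in> \<Gamma> - H"
        moreover obtain n N where l: "l = (n, N)" by fastforce
        ultimately have "x \<notin> cyl n N" using False by blast
        then show "?g l x = 0" by (simp add: l)
      qed
      then show ?thesis by simp
    next
      case True
      then obtain n N where l: "(n, N) \<in> \<Gamma> - H" "x \<in> cyl n N" by blast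
      \<comment> \<open>By separation at most one summand is nonzero at a given point.\<close>
      have other: "x \<notin> cyl n' N'" if "(n', N') \<in> \<Gamma> - H - {(n, N)}" for n' N'
      proof
        assume "x \<in> cyl n' N'"
        then have "3 / 2 * (1 / 3 ^ n) \<le> \<bar>x - x\<bar>"
          using l that by (intro separatedD[OF \<Gamma>(2), of n N n' N']) auto
        moreover have "\<not> 3 / 2 * (1 / 3 ^ n) \<le> \<bar>x - x\<bar>" by (simp add: not_le)
        ultimately show False by contradiction
      qed
      have "(\<Sum>l\<in>\<Gamma> - H. ?g l x) = (\<Sum>l\<in>{(n, N)}. ?g l x)"
      proof (rule sum.mono_neutral_right)
        show "\<forall>l'\<in>\<Gamma> - H - {(n, N)}. ?g l' x = 0"
        proof
          fix l' assume "l' \<in> \<Gamma> - H - {(n, N)}"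
          moreover obtain n' N' where l': "l' = (n', N')" by fastforce
          ultimately have "x \<notin> cyl n' N'" using other by blast
          then show "?g l' x = 0" by (simp add: l')
        qed
      qed (use l \<Gamma> in auto)
      also have "\<dots> = ennreal ((3 / 4) powr r * scale r n)" using l by simp
      also have "\<dots> \<le> ennreal (infdist x \<alpha> powr r)"
      proof (rule ennreal_leI)
        have "3 / 4 * (1 / 3 ^ n) \<le> infdist x \<alpha>"
          unfolding infdist_notempty[OF \<alpha>(2)]
        proof (rule cINF_greatest[OF \<alpha>(2)])
          fix a assume "a \<in> \<alpha>"
          then show "3 / 4 * (1 / 3 ^ n) \<le> dist x a"
            using l by (force simp: H_def near_def dist_real_def not_less)
        qed
        then have "(3 / 4 * (1 / 3 ^ n)) powr r \<le> infdist x \<alpha> powr r"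
          by (intro powr_mono2) (use r in auto)
        moreover have "(3 / 4 * (1 / 3 ^ n)) powr r = (3 / 4) powr r * scale r n"
          unfolding scale_def by (rule powr_mult)
        ultimately show "(3 / 4) powr r * scale r n \<le> infdist x \<alpha> powr r" by simp
      qed
      finally show ?thesis .
    qed
  qed
  finally show ?thesis .
qed

text \<open>A family of at least \<open>2 * k\<close> separated intervals faces at most
  \<open>k\<close> points, so at least \<open>k\<close> intervals are missed, each costing a fixed
  multiple of \<epsilon>.\<close>

lemma quant_V_lower:
  assumes "0 < r" "0 < s" "s < 1" "r * s * ln 3 < pressure p s"
  shows "\<exists>C>0. \<forall>k\<ge>1. ennreal (C * real k powr (- (1 - s) / s)) \<le> quant_V k r \<nu>"
proof -
  obtain m G where mG: "1 \<le> m" "G \<subseteq> vals m"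
    "\<And>A B. A \<in> G \<Longrightarrow> B \<in> G \<Longrightarrow> A < B \<Longrightarrow> A + 2 \<le> B"
    "1 \<le> (\<Sum>A\<in>G. (vweight p m A * scale r m) powr s)"
    using ex_spaced_subset[OF assms(1,2,4)] by metis
  obtain c where c: "c > 0" "\<And>\<epsilon>. 0 < \<epsilon> \<Longrightarrow> \<epsilon> \<le> 1 \<Longrightarrow>
      \<exists>\<Gamma>. finite \<Gamma> \<and> separated \<Gamma> \<and> \<epsilon> powr - s \<le> card \<Gamma> \<and>
        (\<forall>n N. (n, N) \<in> \<Gamma> \<longrightarrow> N \<in> vals n \<and> c * \<epsilon> \<le> vweight p n N * scale r n)"
    using ex_separated_family[OF assms(1) mG(1) assms(2) mG(2-4)] by auto
  define C where "C = (3 / 4) powr r * c * 2 powr (- 1 / s)"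
  have "ennreal (C * real k powr (- (1 - s) / s)) \<le> quant_V k r \<nu>" if k: "1 \<le> k" for k
  proof -
    \<comment> \<open>The solution of \<open>\<epsilon> powr - s = 2 * k\<close>.\<close>
    define \<epsilon> where "\<epsilon> = (2 * real k) powr (- 1 / s)"
    have \<epsilon>: "0 < \<epsilon>" "\<epsilon> \<le> 1"
      using k assms powr_mono2'[of "- 1 / s" 1 "2 * real k"] by (auto simp: \<epsilon>_def)
    have \<epsilon>s: "\<epsilon> powr - s = 2 * real k"
      using k assms by (simp add: \<epsilon>_def powr_powr)
    obtain \<Gamma> where \<Gamma>: "finite \<Gamma>" "separated \<Gamma>" "\<epsilon> powr - s \<le> card \<Gamma>"
      "\<And>n N. (n, N) \<in> \<Gamma> \<Longrightarrow> c * \<epsilon> \<le> vweight p n N * scale r n"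
      using c(2)[OF \<epsilon>] by blast
    have "C * real k powr (- (1 - s) / s) = real k * ((3 / 4) powr r * (c * \<epsilon>))"
    proof -
      have "real k powr (- (1 - s) / s) = real k powr (1 + - 1 / s)"
        using assms by (simp add: field_simps)
      also have "\<dots> = real k * real k powr (- 1 / s)"
        unfolding powr_add using k by simp
      finally show ?thesis
        by (simp add: C_def \<epsilon>_def powr_mult)
    qed
    also have "ennreal \<dots> \<le> quant_V k r \<nu>"
      unfolding quant_V_def
    proof (rule INF_greatest, clarify)
      fix \<alpha> :: "real set" assume \<alpha>: "finite \<alpha>" "1 \<le> card \<alpha>" "card \<alpha> \<le> k"
      have "real k \<le> real (card \<Gamma> - card \<alpha>)"
        using \<Gamma>(3) \<epsilon>s \<alpha> by linarith
      then have "real k * ((3 / 4) powr r * (c * \<epsilon>)) \<le> real (card \<Gamma> - card \<alpha>) * ((3 / 4) powr r * (c * \<epsilon>))"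
        using c(1) \<epsilon> by (intro mult_right_mono) auto
      then have "ennreal (real k * ((3 / 4) powr r * (c * \<epsilon>))) \<le>
          ennreal (real (card \<Gamma> - card \<alpha>) * ((3 / 4) powr r * (c * \<epsilon>)))"
        by (rule ennreal_leI)
      also have "\<dots> \<le> (\<integral>\<^sup>+ x. ennreal (infdist x \<alpha> powr r) \<partial>\<nu>)"
        by (rule separated_nn_integral_ge) (use assms \<Gamma> c(1) \<epsilon> \<alpha> in auto)
      finally show "ennreal (real k * ((3 / 4) powr r * (c * \<epsilon>))) \<le>
          (\<integral>\<^sup>+ x. ennreal (infdist x \<alpha> powr r) \<partial>\<nu>)" .
    qed
    finally show ?thesis .
  qed
  moreover have "0 < C" using c(1) by (simp add: C_def)
  ultimately show ?thesis by blast
qed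

subsection \<open>The quantization dimension\<close>

lemma pressure_less_above_root:
  assumes "0 < r" "pressure_root p r t" "t < s"
  shows "pressure p s < r * s * ln 3"
proof -
  have "pressure p s \<le> pressure p t" using assms by (intro pressure_antimono) simp
  also have "\<dots> = r * t * ln 3" using assms by (simp add: pressure_root_def)
  also have "\<dots> < r * s * ln 3" using assms by simp
  finally show ?thesis .
qed

lemma pressure_greater_below_root:
  assumes "0 < r" "pressure_root p r t" "s < t"
  shows "r * s * ln 3 < pressure p s"
proof -
  have "r * s * ln 3 < r * t * ln 3" using assms by simp
  also have "\<dots> = pressure p t" using assms by (simp add: pressure_root_def)
  also have "\<dots> \<le> pressure p s" using assms by (intro pressure_antimono) simp
  finally show ?thesis .
qed

text \<open>The reciprocal of the dimension quotient is used because its denominator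
  \<open>ln k\<close> is explicit. Exponents \<open>s > t\<close> bound it from below and
  \<open>s < t\<close> from above, and the bounds meet by continuity of
  \<open>(1 - s) / (r * s)\<close> at \<open>t\<close>.\<close>

lemma quant_exponent_tendsto:
  assumes "0 < r" and root: "pressure_root p r t"
  shows "(\<lambda>k. - ln (quant_e k r \<nu>) / ln (real k)) \<longlonglongrightarrow> (1 - t) / (r * t)"
proof -
  let ?F = "\<lambda>s. (1 - s) / (r * s)"
  have t: "0 < t" "t < 1" "pressure p t = r * t * ln 3"
    using root by (auto simp: pressure_root_def)
  have cont: "(?F \<longlongrightarrow> ?F t) (at t)"
    using t assms by (intro tendsto_intros) auto
  have ln_e: "ln (quant_e k r \<nu>) = ln (enn2real (quant_V k r \<nu>)) / r" for k
    by (simp add: quant_e_def ln_powr)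
  have ln_top: "filterlim (\<lambda>k. ln (real k)) at_top sequentially"
    by (rule filterlim_compose[OF ln_at_top filterlim_real_sequentially])
  \<comment> \<open>Multiplicative constants in the bounds for \<open>quant_V\<close> disappear
    after division by \<open>ln k\<close>.\<close>
  have const: "(\<lambda>k. ?F s + D / ln (real k)) \<longlonglongrightarrow> ?F s" for s D
    using tendsto_add[OF tendsto_const real_tendsto_divide_at_top[OF tendsto_const ln_top]]
    by simp
  \<comment> \<open>\<open>enn2real\<close> sends infinity to 0, so finiteness is required before a
    lower bound can pass to the reals.\<close>
  have fin: "\<forall>\<^sub>F k in sequentially. quant_V k r \<nu> < \<top>"
  proof -
    obtain s where s: "t < s" "s < 1" using dense[OF t(2)] by blast
    have "pressure p s < r * s * ln 3"
      by (rule pressure_less_above_root[OF assms s(1)])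
    then obtain C where "\<forall>\<^sub>F k in sequentially. quant_V k r \<nu> \<le> ennreal (C * real k powr (- (1 - s) / s))"
      using quant_V_upper[of r s] s t assms by auto
    then show ?thesis
      by eventually_elim (simp add: le_less_trans)
  qed
  show ?thesis
  proof (rule order_tendstoI)
    fix a assume a: "a < ?F t"
    have "\<forall>\<^sub>F s in at_right t. a < ?F s"
      using order_tendstoD(1)[OF cont a] by (simp add: eventually_at_split)
    moreover have "\<forall>\<^sub>F s in at_right t. s \<in> {t<..<1}"
      using eventually_at_right_real[OF t(2)] .
    ultimately have "\<forall>\<^sub>F s in at_right t. a < ?F s \<and> s \<in> {t<..<1}"
      by (rule eventually_conj)
    then obtain s where s: "a < ?F s" "t < s" "s < 1"
      using eventually_happens[of _ "at_right t"] by auto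
    have "pressure p s < r * s * ln 3"
      by (rule pressure_less_above_root[OF assms s(2)])
    then obtain C where C: "0 < C"
      "\<forall>\<^sub>F k in sequentially. quant_V k r \<nu> \<le> ennreal (C * real k powr (- (1 - s) / s))"
      using quant_V_upper[of r s] s t assms by auto
    \<comment> \<open>The auxiliary exponent below \<open>t\<close> only supplies positivity of
      \<open>quant_V\<close>, without which the upper bound could not be passed through
      \<open>ln\<close>.\<close>
    obtain u where u: "0 < u" "u < 1" "u < t" "r * u * ln 3 < pressure p u"
    proof -
      obtain u where "0 < u" "u < t" using dense[OF t(1)] by blast
      moreover have "r * u * ln 3 < pressure p u"
        by (rule pressure_greater_below_root[OF assms \<open>u < t\<close>])
      ultimately show ?thesis using that t by auto
    qed
    obtain C' where C': "0 < C'" "\<And>k. 1 \<le> k \<Longrightarrow> ennreal (C' * real k powr (- (1 - u) / u)) \<le> quant_V k r \<nu>"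
      using quant_V_lower[OF assms(1) u(1,2,4)] by auto
    have "\<forall>\<^sub>F k in sequentially. a < ?F s + (- ln C / r) / ln (real k)"
      using order_tendstoD(1)[OF const s(1)] .
    then show "\<forall>\<^sub>F k in sequentially. a < - ln (quant_e k r \<nu>) / ln (real k)"
      using C(2) eventually_ge_at_top[of 2]
    proof eventually_elim
      case (elim k)
      have k: "1 < real k" "0 < ln (real k)" using elim(3) by auto
      let ?V = "enn2real (quant_V k r \<nu>)"
      have V: "?V \<le> C * real k powr (- (1 - s) / s)"
        using enn2real_mono[OF elim(2)] C(1) by simp
      have "0 < C' * real k powr (- (1 - u) / u)" using C'(1) k by simp
      also have "\<dots> \<le> ?V"
        using enn2real_mono[OF C'(2)[of k]] elim(2,3) C'(1)
        by (simp add: le_less_trans)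
      finally have "0 < ?V" .
      then have "ln ?V \<le> ln (C * real k powr (- (1 - s) / s))"
        using V C(1) k by simp
      also have "\<dots> = ln C - (1 - s) / s * ln (real k)"
        using C(1) k s t by (simp add: ln_mult ln_powr field_simps)
      finally have "(1 - s) / s * ln (real k) - ln C \<le> - ln ?V" by simp
      then have "((1 - s) / s * ln (real k) - ln C) / (r * ln (real k)) \<le> - ln ?V / (r * ln (real k))"
        using k assms by (intro divide_right_mono) auto
      moreover have "((1 - s) / s * ln (real k) - ln C) / (r * ln (real k)) = ?F s + (- ln C / r) / ln (real k)"
        using k assms s t by (simp add: field_simps)
      ultimately show ?case using elim(1) by (simp add: ln_e mult.commute)
    qed
  next
    fix a assume a: "?F t < a"
    have "\<forall>\<^sub>F s in at_left t. ?F s < a"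
      using order_tendstoD(2)[OF cont a] by (simp add: eventually_at_split)
    moreover have "\<forall>\<^sub>F s in at_left t. s \<in> {0<..<t}"
      using eventually_at_left_real[OF t(1)] .
    ultimately have "\<forall>\<^sub>F s in at_left t. ?F s < a \<and> s \<in> {0<..<t}"
      by (rule eventually_conj)
    then obtain s where s: "?F s < a" "0 < s" "s < t"
      using eventually_happens[of _ "at_left t"] by auto
    have "r * s * ln 3 < pressure p s"
      by (rule pressure_greater_below_root[OF assms s(3)])
    then obtain C where C: "0 < C" "\<And>k. 1 \<le> k \<Longrightarrow> ennreal (C * real k powr (- (1 - s) / s)) \<le> quant_V k r \<nu>"
      using quant_V_lower[of r s] s t assms by auto
    have "\<forall>\<^sub>F k in sequentially. ?F s + (- ln C / r) / ln (real k) < a"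
      using order_tendstoD(2)[OF const s(1)] .
    then show "\<forall>\<^sub>F k in sequentially. - ln (quant_e k r \<nu>) / ln (real k) < a"
      using fin eventually_ge_at_top[of 2]
    proof eventually_elim
      case (elim k)
      have k: "1 < real k" "0 < ln (real k)" using elim(3) by auto
      let ?V = "enn2real (quant_V k r \<nu>)"
      have V: "C * real k powr (- (1 - s) / s) \<le> ?V"
        using enn2real_mono[OF C(2)[of k] elim(2)] elim(3) C(1) by simp
      have "0 < C * real k powr (- (1 - s) / s)" using C(1) k by simp
      then have "ln (C * real k powr (- (1 - s) / s)) \<le> ln ?V"
        using V by simp
      moreover have "ln (C * real k powr (- (1 - s) / s)) = ln C - (1 - s) / s * ln (real k)"
        using C(1) k s t by (simp add: ln_mult ln_powr field_simps)
      ultimately have "- ln ?V \<le> (1 - s) / s * ln (real k) - ln C" by simp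
      then have "- ln ?V / (r * ln (real k)) \<le> ((1 - s) / s * ln (real k) - ln C) / (r * ln (real k))"
        using k assms by (intro divide_right_mono) auto
      moreover have "((1 - s) / s * ln (real k) - ln C) / (r * ln (real k)) = ?F s + (- ln C / r) / ln (real k)"
        using k assms s t by (simp add: field_simps)
      ultimately show ?case using elim(1) by (simp add: ln_e mult.commute)
    qed
  qed
qed

text \<open>The limit of the reciprocals is nonzero because the root is less than 1, so it can be
  inverted, and lower and upper dimension are both equal to the resulting limit.\<close>

lemma has_quant_dim_chi:
  assumes "0 < r"
  shows "has_quant_dim r \<nu> (chi p r)"
proof -
  have root: "pressure_root p r (t_root p r)"
    unfolding t_root_def by (rule theI'[OF ex1_pressure_root[OF assms]])
  then have t: "0 < t_root p r" "t_root p r < 1" by (auto simp: pressure_root_def)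
  have "(\<lambda>k. inverse (- ln (quant_e k r \<nu>) / ln (real k))) \<longlonglongrightarrow>
      inverse ((1 - t_root p r) / (r * t_root p r))"
    by (rule tendsto_inverse[OF quant_exponent_tendsto[OF assms root]]) (use t assms in simp)
  then have "(\<lambda>k. ln (real k) / - ln (quant_e k r \<nu>)) \<longlonglongrightarrow> chi p r"
    by (simp add: chi_def)
  then have lim: "(\<lambda>k. ereal (ln (real k) / - ln (quant_e k r \<nu>))) \<longlonglongrightarrow> ereal (chi p r)"
    by (rule tendsto_ereal)
  show ?thesis
    unfolding has_quant_dim_def lower_quant_dim_def upper_quant_dim_def
    using lim_imp_Liminf[OF _ lim] lim_imp_Limsup[OF _ lim] by simp
qed

end

theorem theorem3p2:
  fixes p :: "nat \<Rightarrow> real" and \<nu> :: "real measure"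
  assumes "positive_prob_vector p"
    and "self_similar_measure p \<nu>"
  shows "(\<forall>t\<ge>0. convergent (pressure_seq p t)) \<and>
    (\<forall>r>0. (\<exists>!t. pressure_root p r t) \<and> has_quant_dim r \<nu> (chi p r))"
proof -
  interpret self_similar p \<nu>
    by unfold_locales (use assms in auto)
  show ?thesis
    using convergent_pressure_seq ex1_pressure_root has_quant_dim_chi by blast
qed

end
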